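(* Let $\mathcal{C}$ be a finite connected category and let $S$ be a simple $\mathcal{C}$-set. Then the mark of $S$, that is, the function $\varphi_S\colon B^S(\mathcal{C})\to\mathbb{Z}$ determined by $[\Omega]\mapsto|\operatorname{Hom}_{\mathcal{C}\text{-set}}(S,\Omega)|$, is a ring homomorphism.
   Context: For a finite category $\mathcal{C}$ with object set $\mathcal{C}_0$, a $\mathcal{C}$-set is a covariant functor $\Omega$ from $\mathcal{C}$ to the category of finite sets; morphisms of $\mathcal{C}$-sets are natural transformations, and $\operatorname{Hom}_{\mathcal{C}\text{-set}}(\Omega,\Psi)$ denotes the set of them; a $\mathcal{C}$-subset is a subfunctor. Disjoint unions and products of $\mathcal{C}$-sets are formed objectwise. A $\mathcal{C}$-set is simple if it is non-empty and its only $\mathcal{C}$-subsets are itself and the empty $\mathcal{C}$-set (sending every object to $\emptyset$). The socle $\operatorname{soc}(\Omega)$ is the union of all simple $\mathcal{C}$-subsets of $\Omega$ (this union is disjoint). $1_{\mathcal{C}}$ is the $\mathcal{C}$-set sending every object to a one-point set. The simple Burnside ring $B^S(\mathcal{C})$ is the Grothendieck group, with respect to disjoint union, of isomorphism classes of finite disjoint unions of simple $\mathcal{C}$-sets (equivalently, the free abelian group on isomorphism classes of simple $\mathcal{C}$-sets), with the bilinear product determined by $[S]\star[T]=[\operatorname{soc}(S\times T)]$ and identity element $[\operatorname{soc}(1_{\mathcal{C}})]$. Ring homomorphisms preserve identity elements. Here $\Omega$ ranges over finite disjoint unions of simple $\mathcal{C}$-sets, and $\varphi_S$ is extended to the Grothendieck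 group by additivity. *)

theory Defs
  imports "HOL-Algebra.IntRing" "HOL-Library.FuncSet"
begin

section \<open>Finite connected categories\<close>

text \<open>\<open>Comp C g f\<close> is the composite ``\<open>g\<close> after \<open>f\<close>''.\<close>

record ('o, 'm) category =
  Obj :: "'o set"
  Arr :: "'m set"
  Dom :: "'m \<Rightarrow> 'o"
  Cod :: "'m \<Rightarrow> 'o"
  Ident :: "'o \<Rightarrow> 'm"
  Comp :: "'m \<Rightarrow> 'm \<Rightarrow> 'm"

locale category =
  fixes C :: "('o, 'm) category"
  assumes Dom_in: "f \<in> Arr C \<Longrightarrow> Dom C f \<in> Obj C"
    and Cod_in: "f \<in> Arr C \<Longrightarrow> Cod C f \<in> Obj C"
    and Ident_in: "a \<in> Obj C \<Longrightarrow> Ident C a \<in> Arr C"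
    and Dom_Ident: "a \<in> Obj C \<Longrightarrow> Dom C (Ident C a) = a"
    and Cod_Ident: "a \<in> Obj C \<Longrightarrow> Cod C (Ident C a) = a"
    and Comp_in: "\<lbrakk>f \<in> Arr C; g \<in> Arr C; Cod C f = Dom C g\<rbrakk> \<Longrightarrow> Comp C g f \<in> Arr C"
    and Dom_Comp: "\<lbrakk>f \<in> Arr C; g \<in> Arr C; Cod C f = Dom C g\<rbrakk> \<Longrightarrow> Dom C (Comp C g f) = Dom C f"
    and Cod_Comp: "\<lbrakk>f \<in> Arr C; g \<in> Arr C; Cod C f = Dom C g\<rbrakk> \<Longrightarrow> Cod C (Comp C g f) = Cod C g"
    and Comp_Ident: "f \<in> Arr C \<Longrightarrow> Comp C f (Ident C (Dom C f)) = f"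
    and Ident_Comp: "f \<in> Arr C \<Longrightarrow> Comp C (Ident C (Cod C f)) f = f"
    and Comp_assoc: "\<lbrakk>f \<in> Arr C; g \<in> Arr C; h \<in> Arr C; Cod C f = Dom C g; Cod C g = Dom C h\<rbrakk>
      \<Longrightarrow> Comp C h (Comp C g f) = Comp C (Comp C h g) f"

locale finite_category = category +
  assumes finite_Obj: "finite (Obj C)"
    and finite_Arr: "finite (Arr C)"

text \<open>Connected: non-empty, and any two objects are joined by a zigzag of morphisms.\<close>

definition connected_category :: "('o, 'm) category \<Rightarrow> bool" where
  "connected_category C \<longleftrightarrow> Obj C \<noteq> {} \<and>
     (\<forall>a \<in> Obj C. \<forall>b \<in> Obj C.
        (a, b) \<in> ({(Dom C f, Cod C f) | f. f \<in> Arr C} \<union> {(Cod C f, Dom C f) | f. f \<in> Arr C})\<^sup>*)"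

section \<open>\<open>C\<close>-sets\<close>

text \<open>
  Only the values of \<open>Ob \<Omega>\<close> on objects, of \<open>Mp \<Omega>\<close> on morphisms, and of \<open>Mp \<Omega> f\<close> on
  \<open>Ob \<Omega> (Dom C f)\<close> are meaningful; the definitions below do not depend on the others.
\<close>

record ('o, 'm, 'x) cset =
  Ob :: "'o \<Rightarrow> 'x set"
  Mp :: "'m \<Rightarrow> 'x \<Rightarrow> 'x"

definition is_cset :: "('o, 'm) category \<Rightarrow> ('o, 'm, 'x) cset \<Rightarrow> bool" where
  "is_cset C \<Omega> \<longleftrightarrow>
     (\<forall>a \<in> Obj C. finite (Ob \<Omega> a)) \<and>
     (\<forall>f \<in> Arr C. Mp \<Omega> f \<in> Ob \<Omega> (Dom C f) \<rightarrow> Ob \<Omega> (Cod C f)) \<and>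
     (\<forall>a \<in> Obj C. \<forall>x \<in> Ob \<Omega> a. Mp \<Omega> (Ident C a) x = x) \<and>
     (\<forall>f \<in> Arr C. \<forall>g \<in> Arr C. Cod C f = Dom C g \<longrightarrow>
        (\<forall>x \<in> Ob \<Omega> (Dom C f). Mp \<Omega> (Comp C g f) x = Mp \<Omega> g (Mp \<Omega> f x)))"

text \<open>
  Components of natural transformations are extensional functions, so that \<open>Hom\<^sub>C\<^sub>S C \<Omega> \<Psi>\<close>
  contains each natural transformation exactly once and can be counted by \<^const>\<open>card\<close>.
\<close>

definition cset_hom :: "('o, 'm) category \<Rightarrow> ('o, 'm, 'x) cset \<Rightarrow> ('o, 'm, 'y) cset
    \<Rightarrow> ('o \<Rightarrow> 'x \<Rightarrow> 'y) set" (\<open>Hom\<^sub>C\<^sub>S\<close>) where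
  "Hom\<^sub>C\<^sub>S C \<Omega> \<Psi> = {\<eta> \<in> (\<Pi>\<^sub>E a \<in> Obj C. Ob \<Omega> a \<rightarrow>\<^sub>E Ob \<Psi> a).
     \<forall>f \<in> Arr C. \<forall>x \<in> Ob \<Omega> (Dom C f). \<eta> (Cod C f) (Mp \<Omega> f x) = Mp \<Psi> f (\<eta> (Dom C f) x)}"

definition cset_iso :: "('o, 'm) category \<Rightarrow> ('o, 'm, 'x) cset \<Rightarrow> ('o, 'm, 'y) cset \<Rightarrow> bool" where
  "cset_iso C \<Omega> \<Psi> \<longleftrightarrow> (\<exists>\<eta> \<in> Hom\<^sub>C\<^sub>S C \<Omega> \<Psi>. \<exists>\<theta> \<in> Hom\<^sub>C\<^sub>S C \<Psi> \<Omega>. \<forall>a \<in> Obj C.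
     (\<forall>x \<in> Ob \<Omega> a. \<theta> a (\<eta> a x) = x) \<and> (\<forall>y \<in> Ob \<Psi> a. \<eta> a (\<theta> a y) = y))"

definition csubset :: "('o, 'm) category \<Rightarrow> ('o, 'm, 'x) cset \<Rightarrow> ('o, 'm, 'x) cset \<Rightarrow> bool" where
  "csubset C \<Upsilon> \<Omega> \<longleftrightarrow> is_cset C \<Upsilon> \<and> (\<forall>a \<in> Obj C. Ob \<Upsilon> a \<subseteq> Ob \<Omega> a) \<and>
     (\<forall>f \<in> Arr C. \<forall>x \<in> Ob \<Upsilon> (Dom C f). Mp \<Upsilon> f x = Mp \<Omega> f x)"

definition cempty :: "('o, 'm, 'x) cset" where
  "cempty = \<lparr>Ob = (\<lambda>a. {}), Mp = (\<lambda>f x. x)\<rparr>"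

definition cterminal :: "('o, 'm, unit) cset" where
  "cterminal = \<lparr>Ob = (\<lambda>a. {()}), Mp = (\<lambda>f x. x)\<rparr>"

definition csum :: "('o, 'm, 'x) cset \<Rightarrow> ('o, 'm, 'y) cset \<Rightarrow> ('o, 'm, 'x + 'y) cset" where
  "csum \<Omega> \<Psi> = \<lparr>Ob = (\<lambda>a. Ob \<Omega> a <+> Ob \<Psi> a), Mp = (\<lambda>f. map_sum (Mp \<Omega> f) (Mp \<Psi> f))\<rparr>"

definition cprod :: "('o, 'm, 'x) cset \<Rightarrow> ('o, 'm, 'y) cset \<Rightarrow> ('o, 'm, 'x \<times> 'y) cset" where
  "cprod \<Omega> \<Psi> = \<lparr>Ob = (\<lambda>a. Ob \<Omega> a \<times> Ob \<Psi> a), Mp = (\<lambda>f. map_prod (Mp \<Omega> f) (Mp \<Psi> f))\<rparr>"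

definition cfamily_sum :: "'i set \<Rightarrow> ('i \<Rightarrow> ('o, 'm, 'x) cset) \<Rightarrow> ('o, 'm, 'i \<times> 'x) cset" where
  "cfamily_sum I F = \<lparr>Ob = (\<lambda>a. SIGMA i:I. Ob (F i) a), Mp = (\<lambda>f (i, x). (i, Mp (F i) f x))\<rparr>"

definition simple_cset :: "('o, 'm) category \<Rightarrow> ('o, 'm, 'x) cset \<Rightarrow> bool" where
  "simple_cset C S \<longleftrightarrow> is_cset C S \<and> (\<exists>a \<in> Obj C. Ob S a \<noteq> {}) \<and>
     (\<forall>\<Upsilon>. csubset C \<Upsilon> S \<longrightarrow> (\<forall>a \<in> Obj C. Ob \<Upsilon> a = Ob S a) \<or> (\<forall>a \<in> Obj C. Ob \<Upsilon> a = {}))"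

definition soc :: "('o, 'm) category \<Rightarrow> ('o, 'm, 'x) cset \<Rightarrow> ('o, 'm, 'x) cset" where
  "soc C \<Omega> = \<lparr>Ob = (\<lambda>a. \<Union>\<Upsilon> \<in> {\<Upsilon>. csubset C \<Upsilon> \<Omega> \<and> simple_cset C \<Upsilon>}. Ob \<Upsilon> a), Mp = Mp \<Omega>\<rparr>"

text \<open>
  Finite disjoint unions of simple \<open>C\<close>-sets, up to isomorphism; the empty union is allowed.
\<close>

definition semisimple_cset :: "('o, 'm) category \<Rightarrow> ('o, 'm, 'x) cset \<Rightarrow> bool" where
  "semisimple_cset C \<Omega> \<longleftrightarrow> is_cset C \<Omega> \<and>
     (\<exists>(I :: nat set) (F :: nat \<Rightarrow> ('o, 'm, 'x) cset).
        finite I \<and> (\<forall>i \<in> I. simple_cset C (F i)) \<and> cset_iso C \<Omega> (cfamily_sum I F))"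

section \<open>The simple Burnside ring\<close>

text \<open>
  If \<open>C\<close> is finite, every \<open>C\<close>-set is isomorphic to one whose elements are natural numbers. The
  isomorphism class of a \<open>C\<close>-set with elements of an arbitrary type is represented by the set of
  all \<open>C\<close>-sets of natural numbers isomorphic to it.
\<close>

definition iso_class :: "('o, 'm) category \<Rightarrow> ('o, 'm, 'x) cset \<Rightarrow> ('o, 'm, nat) cset set" where
  "iso_class C \<Omega> = {\<Upsilon>. is_cset C \<Upsilon> \<and> cset_iso C \<Omega> \<Upsilon>}"

text \<open>
  The semiring of isomorphism classes of finite disjoint unions of simple \<open>C\<close>-sets. Since the
  socle of a disjoint union is the disjoint union of the socles, \<open>[\<Omega>], [\<Psi>] \<mapsto> [soc (\<Omega> \<times> \<Psi>)]\<close> is the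
  biadditive extension of its restriction to simple \<open>\<Omega>\<close> and \<open>\<Psi>\<close>.
\<close>

definition simple_burnside_semiring :: "('o, 'm) category \<Rightarrow> ('o, 'm, nat) cset set ring" where
  "simple_burnside_semiring C =
     \<lparr>carrier = {iso_class C \<Omega> | \<Omega> :: ('o, 'm, nat) cset. semisimple_cset C \<Omega>},
      mult = (\<lambda>X Y. \<Union>\<Omega> \<in> X. \<Union>\<Psi> \<in> Y. iso_class C (soc C (cprod \<Omega> \<Psi>))),
      one = iso_class C (soc C cterminal),
      zero = iso_class C (cempty :: ('o, 'm, nat) cset),
      add = (\<lambda>X Y. \<Union>\<Omega> \<in> X. \<Union>\<Psi> \<in> Y. iso_class C (csum \<Omega> \<Psi>))\<rparr>"

text \<open>
  The Grothendieck group of the additive monoid of \<open>M\<close>: the class of \<open>(a, b)\<close> is the formal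
  difference \<open>a - b\<close>. The multiplication of \<open>M\<close> is extended bilinearly.
\<close>

definition groth_rel :: "('a, 'b) ring_scheme \<Rightarrow> (('a \<times> 'a) \<times> ('a \<times> 'a)) set" where
  "groth_rel M = {((a, b), (c, d)) | a b c d.
     a \<in> carrier M \<and> b \<in> carrier M \<and> c \<in> carrier M \<and> d \<in> carrier M \<and>
     (\<exists>e \<in> carrier M. a \<oplus>\<^bsub>M\<^esub> d \<oplus>\<^bsub>M\<^esub> e = c \<oplus>\<^bsub>M\<^esub> b \<oplus>\<^bsub>M\<^esub> e)}"

definition groth_class :: "('a, 'b) ring_scheme \<Rightarrow> 'a \<Rightarrow> 'a \<Rightarrow> ('a \<times> 'a) set" where
  "groth_class M a b = groth_rel M `` {(a, b)}"

definition grothendieck_ring :: "('a, 'b) ring_scheme \<Rightarrow> ('a \<times> 'a) set ring" where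
  "grothendieck_ring M =
     \<lparr>carrier = (carrier M \<times> carrier M) // groth_rel M,
      mult = (\<lambda>X Y. \<Union>(a, b) \<in> X. \<Union>(c, d) \<in> Y.
        groth_class M (a \<otimes>\<^bsub>M\<^esub> c \<oplus>\<^bsub>M\<^esub> b \<otimes>\<^bsub>M\<^esub> d) (a \<otimes>\<^bsub>M\<^esub> d \<oplus>\<^bsub>M\<^esub> b \<otimes>\<^bsub>M\<^esub> c)),
      one = groth_class M \<one>\<^bsub>M\<^esub> \<zero>\<^bsub>M\<^esub>,
      zero = groth_class M \<zero>\<^bsub>M\<^esub> \<zero>\<^bsub>M\<^esub>,
      add = (\<lambda>X Y. \<Union>(a, b) \<in> X. \<Union>(c, d) \<in> Y.
        groth_class M (a \<oplus>\<^bsub>M\<^esub> c) (b \<oplus>\<^bsub>M\<^esub> d))\<rparr>"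

definition simple_burnside_ring ::
    "('o, 'm) category \<Rightarrow> (('o, 'm, nat) cset set \<times> ('o, 'm, nat) cset set) set ring" (\<open>B\<^sup>S\<close>) where
  "B\<^sup>S C = grothendieck_ring (simple_burnside_semiring C)"

definition burnside_class :: "('o, 'm) category \<Rightarrow> ('o, 'm, 'x) cset
    \<Rightarrow> (('o, 'm, nat) cset set \<times> ('o, 'm, nat) cset set) set" where
  "burnside_class C \<Omega> =
     groth_class (simple_burnside_semiring C) (iso_class C \<Omega>) \<zero>\<^bsub>simple_burnside_semiring C\<^esub>"

text \<open>
  The additive extension of \<open>[\<Omega>] \<mapsto> |Hom\<^sub>C\<^sub>S C S \<Omega>|\<close>: every element of the Grothendieck group is a
  difference \<open>[\<Omega>] - [\<Psi>]\<close>.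
\<close>

definition mark :: "('o, 'm) category \<Rightarrow> ('o, 'm, 's) cset
    \<Rightarrow> (('o, 'm, nat) cset set \<times> ('o, 'm, nat) cset set) set \<Rightarrow> int" where
  "mark C S \<xi> = (THE n. \<exists>(\<Omega> :: ('o, 'm, nat) cset) (\<Psi> :: ('o, 'm, nat) cset).
     semisimple_cset C \<Omega> \<and> semisimple_cset C \<Psi> \<and>
     \<xi> = burnside_class C \<Omega> \<ominus>\<^bsub>B\<^sup>S C\<^esub> burnside_class C \<Psi> \<and>
     n = int (card (Hom\<^sub>C\<^sub>S C S \<Omega>)) - int (card (Hom\<^sub>C\<^sub>S C S \<Psi>)))"

end

theory Submission
  imports Defs
begin

text \<open>
  Call \<open>x \<in> \<Omega>(a)\<close> recurrent if every \<open>f : a \<rightarrow> b\<close> admits some \<open>g : b \<rightarrow> a\<close> with \<open>g f x = x\<close>; equivalently,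
  the \<open>C\<close>-subset generated by \<open>x\<close> is simple. Hence the socle consists of the recurrent elements,
  the finite disjoint unions of simple \<open>C\<close>-sets are those in which every element is recurrent, and
  \<open>soc (soc (\<Omega> \<times> \<Psi>) \<times> \<Phi>)\<close> and \<open>soc (\<Omega> \<times> soc (\<Psi> \<times> \<Phi>))\<close> both consist of the recurrent triples.

  A simple \<open>S\<close> is generated by any \<open>x \<in> S(a)\<close>, so \<open>Hom(S, \<Omega>)\<close> is in bijection with the elements \<open>y \<in> \<Omega>(a)\<close>
  such that \<open>f y = g y\<close> whenever \<open>f\<close> and \<open>g\<close> are parallel with \<open>f x = g x\<close>. This set is additive in \<open>\<Omega>\<close>
  and multiplicative for products, and its elements are recurrent because \<open>g f x = x\<close> implies
  \<open>g f y = y\<close>; so it does not change when \<open>\<Omega>\<close> is replaced by its socle.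
\<close>

section \<open>The Grothendieck ring of a semiring\<close>

context semiring
begin

lemma groth_rel_iff:
  "((a, b), (c, d)) \<in> groth_rel R \<longleftrightarrow> a \<in> carrier R \<and> b \<in> carrier R \<and> c \<in> carrier R \<and> d \<in> carrier R \<and>
     (\<exists>e \<in> carrier R. a \<oplus> d \<oplus> e = c \<oplus> b \<oplus> e)"
  by (auto simp: groth_rel_def)

text \<open>The auxiliary summand \<open>e\<close> in \<open>groth_rel\<close> is what makes
  transitivity work, since addition in \<open>R\<close> need not be cancellative.\<close>

lemma equiv_groth_rel: "equiv (carrier R \<times> carrier R) (groth_rel R)"
proof (rule equivI)
  show "refl_on (carrier R \<times> carrier R) (groth_rel R)"
    by (auto simp: refl_on_def groth_rel_iff)
  show "groth_rel R \<subseteq> (carrier R \<times> carrier R) \<times> (carrier R \<times> carrier R)"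
    by (auto simp: groth_rel_iff)
  show "sym (groth_rel R)"
    by (rule symI) (clarsimp simp: groth_rel_iff, metis)
  show "trans (groth_rel R)"
  proof (rule transI, clarify)
    fix a b c d a' b'
    assume "((a, b), (c, d)) \<in> groth_rel R" "((c, d), (a', b')) \<in> groth_rel R"
    then obtain e e' where in_R: "a \<in> carrier R" "b \<in> carrier R" "c \<in> carrier R" "d \<in> carrier R"
        "a' \<in> carrier R" "b' \<in> carrier R" "e \<in> carrier R" "e' \<in> carrier R"
      and eq: "a \<oplus> d \<oplus> e = c \<oplus> b \<oplus> e" "c \<oplus> b' \<oplus> e' = a' \<oplus> d \<oplus> e'"
      by (auto simp: groth_rel_iff)
    have "a \<oplus> b' \<oplus> (c \<oplus> d \<oplus> e \<oplus> e') = (a \<oplus> d \<oplus> e) \<oplus> (c \<oplus> b' \<oplus> e')"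
      using in_R by (simp add: a_ac)
    also have "\<dots> = a' \<oplus> b \<oplus> (c \<oplus> d \<oplus> e \<oplus> e')"
      unfolding eq using in_R by (simp add: a_ac)
    finally show "((a, b), (a', b')) \<in> groth_rel R"
      using in_R by (auto simp: groth_rel_iff)
  qed
qed

lemma groth_class_eq_iff:
  assumes "a \<in> carrier R" "b \<in> carrier R" "c \<in> carrier R" "d \<in> carrier R"
  shows "groth_class R a b = groth_class R c d \<longleftrightarrow> (\<exists>e \<in> carrier R. a \<oplus> d \<oplus> e = c \<oplus> b \<oplus> e)"
  using assms by (simp add: groth_class_def eq_equiv_class_iff[OF equiv_groth_rel] groth_rel_iff)

lemma groth_class_eqI:
  assumes "a \<in> carrier R" "b \<in> carrier R" "c \<in> carrier R" "d \<in> carrier R" "a \<oplus> d = c \<oplus> b"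
  shows "groth_class R a b = groth_class R c d"
  using assms by (auto simp: groth_class_eq_iff)

lemma groth_class_in_carrier [simp]:
  "a \<in> carrier R \<Longrightarrow> b \<in> carrier R \<Longrightarrow> groth_class R a b \<in> carrier (grothendieck_ring R)"
  by (auto simp: grothendieck_ring_def groth_class_def intro: quotientI)

lemma grothendieck_carrierE:
  assumes "X \<in> carrier (grothendieck_ring R)"
  obtains a b where "a \<in> carrier R" "b \<in> carrier R" "X = groth_class R a b"
  using assms by (auto simp: grothendieck_ring_def groth_class_def elim!: quotientE)

text \<open>The double union in the definition collapses because its terms do not depend on the
  representatives. Commutativity of addition reduces this check to the second argument.\<close>

lemma groth_class_add:
  assumes "a \<in> carrier R" "b \<in> carrier R" "c \<in> carrier R" "d \<in> carrier R"
  shows "groth_class R a b \<oplus>\<^bsub>grothendieck_ring R\<^esub> groth_class R c d = groth_class R (a \<oplus> c) (b \<oplus> d)"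
proof -
  let ?f = "\<lambda>p q. groth_class R (fst p \<oplus> fst q) (snd p \<oplus> snd q)"
  have "congruent2 (groth_rel R) (groth_rel R) ?f"
  proof (rule congruent2_commuteI[OF equiv_groth_rel])
    show "?f p q = ?f q p" if "p \<in> carrier R \<times> carrier R" "q \<in> carrier R \<times> carrier R" for p q
      using that by (auto simp: a_comm)
    show "?f r p = ?f r q" if r: "r \<in> carrier R \<times> carrier R" and "(p, q) \<in> groth_rel R" for p q r
    proof -
      obtain a b c d u v where pq: "p = (a, b)" "q = (c, d)" "r = (u, v)"
        by (cases p, cases q, cases r)
      with that obtain e where in_R: "a \<in> carrier R" "b \<in> carrier R" "c \<in> carrier R" "d \<in> carrier R"
          "u \<in> carrier R" "v \<in> carrier R" "e \<in> carrier R"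
        and eq: "a \<oplus> d \<oplus> e = c \<oplus> b \<oplus> e"
        by (auto simp: groth_rel_iff)
      have "(u \<oplus> a) \<oplus> (v \<oplus> d) \<oplus> e = u \<oplus> v \<oplus> (a \<oplus> d \<oplus> e)"
        using in_R by (simp add: a_ac)
      also have "\<dots> = (u \<oplus> c) \<oplus> (v \<oplus> b) \<oplus> e"
        unfolding eq using in_R by (simp add: a_ac)
      finally show ?thesis
        using in_R pq by (auto simp: groth_class_eq_iff)
    qed
  qed
  from UN_equiv_class2[OF equiv_groth_rel equiv_groth_rel this, of "(a, b)" "(c, d)"] assms
  show ?thesis
    by (simp add: grothendieck_ring_def groth_class_def case_prod_unfold)
qed

text \<open>Again the terms of the double union are independent of the representatives.
  Multiplication need not commute here, so the two arguments are treated separately.\<close>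

lemma groth_class_mult:
  assumes "a \<in> carrier R" "b \<in> carrier R" "c \<in> carrier R" "d \<in> carrier R"
  shows "groth_class R a b \<otimes>\<^bsub>grothendieck_ring R\<^esub> groth_class R c d =
    groth_class R (a \<otimes> c \<oplus> b \<otimes> d) (a \<otimes> d \<oplus> b \<otimes> c)"
proof -
  let ?f = "\<lambda>p q. groth_class R (fst p \<otimes> fst q \<oplus> snd p \<otimes> snd q) (fst p \<otimes> snd q \<oplus> snd p \<otimes> fst q)"
  have "congruent2 (groth_rel R) (groth_rel R) ?f"
  proof (rule congruent2I[OF equiv_groth_rel equiv_groth_rel])
    show "?f p r = ?f q r" if r: "r \<in> carrier R \<times> carrier R" and "(p, q) \<in> groth_rel R" for p q r
    proof -
      obtain a b c d u v where pq: "p = (a, b)" "q = (c, d)" "r = (u, v)"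
        by (cases p, cases q, cases r)
      with that obtain e where in_R: "a \<in> carrier R" "b \<in> carrier R" "c \<in> carrier R" "d \<in> carrier R"
          "u \<in> carrier R" "v \<in> carrier R" "e \<in> carrier R"
        and eq: "a \<oplus> d \<oplus> e = c \<oplus> b \<oplus> e"
        by (auto simp: groth_rel_iff)
      \<comment> \<open>The relation is multiplied by both \<open>u\<close> and \<open>v\<close>,
        and used forwards in the \<open>u\<close> part and backwards in the \<open>v\<close> part.
        The auxiliary summand becomes \<open>e\<close> times \<open>u\<close> plus \<open>e\<close>
        times \<open>v\<close>.\<close>
      have "(a \<otimes> u \<oplus> b \<otimes> v) \<oplus> (c \<otimes> v \<oplus> d \<otimes> u) \<oplus> (e \<otimes> u \<oplus> e \<otimes> v)
          = (a \<oplus> d \<oplus> e) \<otimes> u \<oplus> (c \<oplus> b \<oplus> e) \<otimes> v"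
        using in_R by (simp add: a_ac l_distr)
      also have "\<dots> = (c \<oplus> b \<oplus> e) \<otimes> u \<oplus> (a \<oplus> d \<oplus> e) \<otimes> v"
        by (simp add: eq)
      also have "\<dots> = (c \<otimes> u \<oplus> d \<otimes> v) \<oplus> (a \<otimes> v \<oplus> b \<otimes> u) \<oplus> (e \<otimes> u \<oplus> e \<otimes> v)"
        using in_R by (simp add: a_ac l_distr)
      finally show ?thesis
        using in_R pq by (auto simp: groth_class_eq_iff)
    qed
    show "?f r p = ?f r q" if r: "r \<in> carrier R \<times> carrier R" and "(p, q) \<in> groth_rel R" for p q r
    proof -
      obtain a b c d u v where pq: "p = (a, b)" "q = (c, d)" "r = (u, v)"
        by (cases p, cases q, cases r)
      with that obtain e where in_R: "a \<in> carrier R" "b \<in> carrier R" "c \<in> carrier R" "d \<in> carrier R"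
          "u \<in> carrier R" "v \<in> carrier R" "e \<in> carrier R"
        and eq: "a \<oplus> d \<oplus> e = c \<oplus> b \<oplus> e"
        by (auto simp: groth_rel_iff)
      have "(u \<otimes> a \<oplus> v \<otimes> b) \<oplus> (u \<otimes> d \<oplus> v \<otimes> c) \<oplus> (u \<otimes> e \<oplus> v \<otimes> e)
          = u \<otimes> (a \<oplus> d \<oplus> e) \<oplus> v \<otimes> (c \<oplus> b \<oplus> e)"
        using in_R by (simp add: a_ac r_distr)
      also have "\<dots> = u \<otimes> (c \<oplus> b \<oplus> e) \<oplus> v \<otimes> (a \<oplus> d \<oplus> e)"
        by (simp add: eq)
      also have "\<dots> = (u \<otimes> c \<oplus> v \<otimes> d) \<oplus> (u \<otimes> b \<oplus> v \<otimes> a) \<oplus> (u \<otimes> e \<oplus> v \<otimes> e)"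
        using in_R by (simp add: a_ac r_distr)
      finally show ?thesis
        using in_R pq by (auto simp: groth_class_eq_iff)
    qed
  qed
  from UN_equiv_class2[OF equiv_groth_rel equiv_groth_rel this, of "(a, b)" "(c, d)"] assms
  show ?thesis
    by (simp add: grothendieck_ring_def groth_class_def case_prod_unfold)
qed

lemma groth_zero: "\<zero>\<^bsub>grothendieck_ring R\<^esub> = groth_class R \<zero> \<zero>"
  and groth_one: "\<one>\<^bsub>grothendieck_ring R\<^esub> = groth_class R \<one> \<zero>"
  by (simp_all add: grothendieck_ring_def)

text \<open>Swapping the entries of a formal difference negates it: both entries of the sum are the
  same element up to commutativity.\<close>

lemma groth_class_swap_add:
  assumes "a \<in> carrier R" "b \<in> carrier R"
  shows "groth_class R b a \<oplus>\<^bsub>grothendieck_ring R\<^esub> groth_class R a b = \<zero>\<^bsub>grothendieck_ring R\<^esub>"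
  using assms by (simp add: groth_class_add groth_zero) (rule groth_class_eqI, simp_all add: a_comm)

lemma ring_grothendieck_ring: "ring (grothendieck_ring R)"
proof (rule ringI)
  show "abelian_group (grothendieck_ring R)"
  proof (rule abelian_groupI)
    fix x assume "x \<in> carrier (grothendieck_ring R)"
    then show "\<exists>y\<in>carrier (grothendieck_ring R). y \<oplus>\<^bsub>grothendieck_ring R\<^esub> x = \<zero>\<^bsub>grothendieck_ring R\<^esub>"
      by (metis grothendieck_carrierE groth_class_swap_add groth_class_in_carrier)
  qed (auto elim!: grothendieck_carrierE simp: groth_class_add groth_zero a_ac)
  show "monoid (grothendieck_ring R)"
    by (rule monoidI) (auto elim!: grothendieck_carrierE
        simp: groth_class_mult groth_one l_distr r_distr a_ac m_assoc)
qed (auto elim!: grothendieck_carrierE simp: groth_class_add groth_class_mult l_distr r_distr a_ac)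

text \<open>Translates the subtraction that occurs in \<open>mark\<close> into a class of pairs, on
  which equality is described by \<open>groth_class_eq_iff\<close>.\<close>

lemma groth_class_minus:
  assumes "a \<in> carrier R" "b \<in> carrier R"
  shows "groth_class R a \<zero> \<ominus>\<^bsub>grothendieck_ring R\<^esub> groth_class R b \<zero> = groth_class R a b"
proof -
  interpret G: ring "grothendieck_ring R" by (rule ring_grothendieck_ring)
  have "\<ominus>\<^bsub>grothendieck_ring R\<^esub> groth_class R b \<zero> = groth_class R \<zero> b"
    using assms by (intro G.minus_equality groth_class_swap_add) auto
  then show ?thesis
    using assms by (simp add: a_minus_def groth_class_add)
qed

text \<open>Every element is a class of a pair, so \<open>H\<close> is the difference extension of
  \<open>h\<close>, and the homomorphism laws reduce to those of \<open>h\<close> by expanding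
  products of differences.\<close>

lemma ring_hom_grothendieckI:
  fixes h :: "_ \<Rightarrow> int"
  assumes H: "\<And>a b. a \<in> carrier R \<Longrightarrow> b \<in> carrier R \<Longrightarrow> H (groth_class R a b) = h a - h b"
    and add: "\<And>a b. a \<in> carrier R \<Longrightarrow> b \<in> carrier R \<Longrightarrow> h (a \<oplus> b) = h a + h b"
    and mult: "\<And>a b. a \<in> carrier R \<Longrightarrow> b \<in> carrier R \<Longrightarrow> h (a \<otimes> b) = h a * h b"
    and one: "h \<one> = 1"
  shows "ring_hom_ring (grothendieck_ring R) \<Z> H"
proof (rule ring_hom_ringI[OF ring_grothendieck_ring])
  show "ring \<Z>" by (rule int.ring_axioms)
  \<comment> \<open>Cancellation in the integers gives this. It is needed because the identity is
    the class of the pair of one and zero.\<close>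
  have "h \<zero> = 0" using add[of \<zero> \<zero>] by simp
  then show "H \<one>\<^bsub>grothendieck_ring R\<^esub> = \<one>\<^bsub>\<Z>\<^esub>"
    by (simp add: groth_one H one)
qed (auto elim!: grothendieck_carrierE simp: H groth_class_add groth_class_mult add mult algebra_simps)

end

section \<open>Recurrent elements and socles\<close>

definition recurrent :: "('o, 'm) category \<Rightarrow> ('o, 'm, 'x) cset \<Rightarrow> 'o \<Rightarrow> 'x \<Rightarrow> bool" where
  "recurrent C \<Omega> a x \<longleftrightarrow> (\<forall>f \<in> Arr C. Dom C f = a \<longrightarrow>
     (\<exists>g \<in> Arr C. Dom C g = Cod C f \<and> Cod C g = a \<and> Mp \<Omega> g (Mp \<Omega> f x) = x))"

text \<open>This is the \<open>C\<close>-subset generated by \<open>x\<close>: the image of the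
  representable functor at \<open>a\<close> under the Yoneda map determined by
  \<open>x\<close>.\<close>

definition orbit :: "('o, 'm) category \<Rightarrow> ('o, 'm, 'x) cset \<Rightarrow> 'o \<Rightarrow> 'x \<Rightarrow> ('o, 'm, 'x) cset" where
  "orbit C \<Omega> a x = \<lparr>Ob = (\<lambda>b. {Mp \<Omega> f x | f. f \<in> Arr C \<and> Dom C f = a \<and> Cod C f = b}), Mp = Mp \<Omega>\<rparr>"

lemma recurrentD:
  assumes "recurrent C \<Omega> a x" "f \<in> Arr C" "Dom C f = a"
  obtains g where "g \<in> Arr C" "Dom C g = Cod C f" "Cod C g = a" "Mp \<Omega> g (Mp \<Omega> f x) = x"
  using assms by (auto simp: recurrent_def)

text \<open>Recurrence refers to the maps only and never to \<open>Ob\<close>, so it is unaffected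
  by passing to a socle, which keeps the maps of the ambient \<open>C\<close>-set.\<close>

lemma recurrent_cong_Mp: "Mp \<Omega> = Mp \<Psi> \<Longrightarrow> recurrent C \<Omega> = recurrent C \<Psi>"
  by (simp add: recurrent_def fun_eq_iff)

lemma Mp_soc [simp]: "Mp (soc C \<Omega>) = Mp \<Omega>"
  by (simp add: soc_def)

lemma Mp_orbit [simp]: "Mp (orbit C \<Omega> a x) = Mp \<Omega>"
  by (simp add: orbit_def)

lemma cprod_simps [simp]:
  "Ob (cprod \<Omega> \<Psi>) a = Ob \<Omega> a \<times> Ob \<Psi> a" "Mp (cprod \<Omega> \<Psi>) f = map_prod (Mp \<Omega> f) (Mp \<Psi> f)"
  by (simp_all add: cprod_def)

lemma csum_simps [simp]:
  "Ob (csum \<Omega> \<Psi>) a = Ob \<Omega> a <+> Ob \<Psi> a" "Mp (csum \<Omega> \<Psi>) f = map_sum (Mp \<Omega> f) (Mp \<Psi> f)"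
  by (simp_all add: csum_def)

lemma cempty_simps [simp]: "Ob cempty a = {}" "Mp cempty f = (\<lambda>x. x)"
  by (simp_all add: cempty_def)

lemma cterminal_simps [simp]: "Ob cterminal a = {()}" "Mp cterminal f = (\<lambda>x. x)"
  by (simp_all add: cterminal_def)

lemma cfamily_sum_simps [simp]:
  "Ob (cfamily_sum I F) a = (SIGMA i:I. Ob (F i) a)"
  "Mp (cfamily_sum I F) f = (\<lambda>(i, x). (i, Mp (F i) f x))"
  by (simp_all add: cfamily_sum_def)

lemma recurrent_csum [simp]:
  "recurrent C (csum \<Omega> \<Psi>) a (Inl x) \<longleftrightarrow> recurrent C \<Omega> a x"
  "recurrent C (csum \<Omega> \<Psi>) a (Inr y) \<longleftrightarrow> recurrent C \<Psi> a y"
  by (simp_all add: recurrent_def)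

text \<open>A morphism returning the pair returns both coordinates. The converse fails in general,
  as the coordinates may need different return morphisms; hence products are followed by a
  socle.\<close>

lemma recurrent_cprodD:
  assumes "recurrent C (cprod \<Omega> \<Psi>) a (x, y)"
  shows "recurrent C \<Omega> a x" "recurrent C \<Psi> a y"
  using assms by (fastforce simp: recurrent_def)+

lemma recurrent_soc [simp]:
  "recurrent C (soc C \<Omega>) = recurrent C \<Omega>"
  "recurrent C (cprod (soc C \<Omega>) \<Psi>) = recurrent C (cprod \<Omega> \<Psi>)"
  "recurrent C (cprod \<Omega> (soc C \<Psi>)) = recurrent C (cprod \<Omega> \<Psi>)"
  by (rule recurrent_cong_Mp, simp add: fun_eq_iff)+

lemma is_csetD:
  assumes "is_cset C \<Omega>"
  shows is_cset_finite: "a \<in> Obj C \<Longrightarrow> finite (Ob \<Omega> a)"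
    and is_cset_Mp: "f \<in> Arr C \<Longrightarrow> Dom C f = a \<Longrightarrow> Cod C f = b \<Longrightarrow> x \<in> Ob \<Omega> a \<Longrightarrow> Mp \<Omega> f x \<in> Ob \<Omega> b"
    and is_cset_Ident: "a \<in> Obj C \<Longrightarrow> x \<in> Ob \<Omega> a \<Longrightarrow> Mp \<Omega> (Ident C a) x = x"
    and is_cset_Comp: "f \<in> Arr C \<Longrightarrow> g \<in> Arr C \<Longrightarrow> Cod C f = Dom C g \<Longrightarrow> x \<in> Ob \<Omega> (Dom C f) \<Longrightarrow>
          Mp \<Omega> (Comp C g f) x = Mp \<Omega> g (Mp \<Omega> f x)"
  using assms by (auto simp: is_cset_def Pi_iff)

lemma is_csetI:
  assumes "\<And>a. a \<in> Obj C \<Longrightarrow> finite (Ob \<Omega> a)"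
    and "\<And>f x. f \<in> Arr C \<Longrightarrow> x \<in> Ob \<Omega> (Dom C f) \<Longrightarrow> Mp \<Omega> f x \<in> Ob \<Omega> (Cod C f)"
    and "\<And>a x. a \<in> Obj C \<Longrightarrow> x \<in> Ob \<Omega> a \<Longrightarrow> Mp \<Omega> (Ident C a) x = x"
    and "\<And>f g x. f \<in> Arr C \<Longrightarrow> g \<in> Arr C \<Longrightarrow> Cod C f = Dom C g \<Longrightarrow> x \<in> Ob \<Omega> (Dom C f) \<Longrightarrow>
          Mp \<Omega> (Comp C g f) x = Mp \<Omega> g (Mp \<Omega> f x)"
  shows "is_cset C \<Omega>"
  using assms by (auto simp: is_cset_def)

lemma is_cset_cempty [simp]: "is_cset C cempty"
  and is_cset_cterminal [simp]: "is_cset C cterminal"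
  by (auto simp: is_cset_def)

context category
begin

lemma is_cset_csum [simp]: "is_cset C \<Omega> \<Longrightarrow> is_cset C \<Psi> \<Longrightarrow> is_cset C (csum \<Omega> \<Psi>)"
  by (rule is_csetI) (auto simp: is_csetD Dom_in)

lemma is_cset_cprod [simp]: "is_cset C \<Omega> \<Longrightarrow> is_cset C \<Psi> \<Longrightarrow> is_cset C (cprod \<Omega> \<Psi>)"
  by (rule is_csetI) (auto simp: is_csetD Dom_in)

text \<open>Recurrence of \<open>x\<close> is applied to \<open>h\<close> after \<open>f\<close>. If
  \<open>g\<close> leads back to \<open>x\<close>, then \<open>f\<close> after \<open>g\<close>
  leads from \<open>h f x\<close> back to \<open>f x\<close>. This makes the socle closed under the
  maps.\<close>

lemma recurrent_Mp:
  assumes \<Omega>: "is_cset C \<Omega>" and x: "recurrent C \<Omega> (Dom C f) x" "x \<in> Ob \<Omega> (Dom C f)" and f: "f \<in> Arr C"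
  shows "recurrent C \<Omega> (Cod C f) (Mp \<Omega> f x)"
  unfolding recurrent_def
proof (intro ballI impI)
  fix h assume h: "h \<in> Arr C" "Dom C h = Cod C f"
  then obtain g where g: "g \<in> Arr C" "Dom C g = Cod C h" "Cod C g = Dom C f"
      "Mp \<Omega> g (Mp \<Omega> (Comp C h f) x) = x"
    using f by (auto intro: recurrentD[OF x(1), of "Comp C h f"] simp: Comp_in Dom_Comp Cod_Comp)
  have "Mp \<Omega> (Comp C f g) (Mp \<Omega> h (Mp \<Omega> f x)) = Mp \<Omega> f x"
    using \<Omega> f x g h by (simp add: is_csetD)
  then show "\<exists>k\<in>Arr C. Dom C k = Cod C h \<and> Cod C k = Cod C f \<and>
      Mp \<Omega> k (Mp \<Omega> h (Mp \<Omega> f x)) = Mp \<Omega> f x"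
    using f g h by (auto intro!: bexI[of _ "Comp C f g"] simp: Comp_in Dom_Comp Cod_Comp)
qed

section \<open>Orbits of single elements and their relation to simple \<open>C\<close>-sets\<close>

lemma csubset_orbit:
  assumes \<Omega>: "is_cset C \<Omega>" and a: "a \<in> Obj C" and x: "x \<in> Ob \<Omega> a"
  shows "csubset C (orbit C \<Omega> a x) \<Omega>" and "x \<in> Ob (orbit C \<Omega> a x) a"
proof -
  have sub: "Ob (orbit C \<Omega> a x) b \<subseteq> Ob \<Omega> b" for b
    using \<Omega> a x by (auto simp: orbit_def is_csetD)
  have "is_cset C (orbit C \<Omega> a x)"
  proof (rule is_csetI)
    fix f y assume f: "f \<in> Arr C" and "y \<in> Ob (orbit C \<Omega> a x) (Dom C f)"
    then obtain h where "h \<in> Arr C" "Dom C h = a" "Cod C h = Dom C f" "y = Mp \<Omega> h x"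
      by (auto simp: orbit_def)
    then have "Comp C f h \<in> Arr C \<and> Dom C (Comp C f h) = a \<and> Cod C (Comp C f h) = Cod C f \<and>
        Mp \<Omega> f y = Mp \<Omega> (Comp C f h) x"
      using \<Omega> f x by (simp add: is_csetD Comp_in Dom_Comp Cod_Comp)
    then show "Mp (orbit C \<Omega> a x) f y \<in> Ob (orbit C \<Omega> a x) (Cod C f)"
      by (auto simp: orbit_def)
  next
    show "finite (Ob (orbit C \<Omega> a x) b)" if "b \<in> Obj C" for b
      using finite_subset[OF sub is_cset_finite[OF \<Omega> that]] .
  qed (use \<Omega> in \<open>simp_all add: is_csetD subsetD[OF sub]\<close>)
  then show "csubset C (orbit C \<Omega> a x) \<Omega>"
    using sub by (auto simp: csubset_def)
  show "x \<in> Ob (orbit C \<Omega> a x) a"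
    using \<Omega> a x by (auto simp: orbit_def is_csetD Ident_in Dom_Ident Cod_Ident intro!: exI[of _ "Ident C a"])
qed

text \<open>The orbit is a \<open>C\<close>-subset containing \<open>x\<close>, so simplicity leaves
  no choice but the whole of \<open>S\<close>.\<close>

lemma simple_cset_orbit_eq:
  assumes S: "simple_cset C S" and "a \<in> Obj C" "x \<in> Ob S a" "b \<in> Obj C"
  shows "Ob (orbit C S a x) b = Ob S b"
proof -
  have "is_cset C S"
    using S by (simp add: simple_cset_def)
  with assms csubset_orbit[of S a x] show ?thesis
    unfolding simple_cset_def by blast
qed

text \<open>The element \<open>f x\<close> generates all of \<open>S\<close>, in particular
  \<open>x\<close>; the morphism that produces \<open>x\<close> is the required way back.\<close>

lemma simple_cset_recurrent:
  assumes S: "simple_cset C S" and a: "a \<in> Obj C" and x: "x \<in> Ob S a"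
  shows "recurrent C S a x"
  unfolding recurrent_def
proof (intro ballI impI)
  fix f assume f: "f \<in> Arr C" "Dom C f = a"
  then have "Mp S f x \<in> Ob S (Cod C f)"
    using S x by (auto simp: simple_cset_def is_csetD)
  from simple_cset_orbit_eq[OF S _ this a] x Cod_in[OF f(1)]
  show "\<exists>g\<in>Arr C. Dom C g = Cod C f \<and> Cod C g = a \<and> Mp S g (Mp S f x) = x"
    by (force simp: orbit_def)
qed

text \<open>Recurrence gives a morphism from \<open>y\<close> back to \<open>x\<close>, so each of
  the two elements generates the other.\<close>

lemma orbit_eq:
  assumes \<Omega>: "is_cset C \<Omega>" and x: "recurrent C \<Omega> a x" "x \<in> Ob \<Omega> a"
    and y: "y \<in> Ob (orbit C \<Omega> a x) b"
  shows "orbit C \<Omega> b y = orbit C \<Omega> a x"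
proof -
  obtain f where f: "f \<in> Arr C" "Dom C f = a" "Cod C f = b" "y = Mp \<Omega> f x"
    using y by (auto simp: orbit_def)
  obtain g where g: "g \<in> Arr C" "Dom C g = b" "Cod C g = a" "Mp \<Omega> g y = x"
    using recurrentD[OF x(1) f(1,2)] f by metis
  have y_in: "y \<in> Ob \<Omega> b"
    using \<Omega> f x by (auto simp: is_csetD)
  \<comment> \<open>Proved for every \<open>c\<close>, not only for objects of \<open>C\<close>, so
    that the orbits coincide as records and can later be counted as elements of a set.\<close>
  have "Ob (orbit C \<Omega> b y) c = Ob (orbit C \<Omega> a x) c" for c
  proof (rule Set.set_eqI)
    have "z \<in> Ob (orbit C \<Omega> a x) c" if "h \<in> Arr C" "Dom C h = b" "Cod C h = c" "z = Mp \<Omega> h y" for z h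
      using that f \<Omega> x by (auto simp: orbit_def is_csetD Comp_in Dom_Comp Cod_Comp intro!: exI[of _ "Comp C h f"])
    moreover have "z \<in> Ob (orbit C \<Omega> b y) c" if "h \<in> Arr C" "Dom C h = a" "Cod C h = c" "z = Mp \<Omega> h x" for z h
      using that g \<Omega> y_in by (auto simp: orbit_def is_csetD Comp_in Dom_Comp Cod_Comp intro!: exI[of _ "Comp C h g"])
    ultimately show "z \<in> Ob (orbit C \<Omega> b y) c \<longleftrightarrow> z \<in> Ob (orbit C \<Omega> a x) c" for z
      by (auto simp: orbit_def)
  qed
  then show ?thesis
    by (simp add: orbit_def fun_eq_iff)
qed

text \<open>Any element \<open>y\<close> of a \<open>C\<close>-subset of the orbit generates the
  whole orbit by \<open>orbit_eq\<close>, so a non-empty \<open>C\<close>-subset is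
  everything.\<close>

lemma simple_orbit:
  assumes \<Omega>: "is_cset C \<Omega>" and a: "a \<in> Obj C" and x: "x \<in> Ob \<Omega> a" "recurrent C \<Omega> a x"
  shows "simple_cset C (orbit C \<Omega> a x)"
  unfolding simple_cset_def
proof (intro conjI allI impI)
  show "is_cset C (orbit C \<Omega> a x)" "\<exists>b\<in>Obj C. Ob (orbit C \<Omega> a x) b \<noteq> {}"
    using csubset_orbit[OF \<Omega> a x(1)] a by (auto simp: csubset_def)
next
  fix \<Upsilon> assume \<Upsilon>: "csubset C \<Upsilon> (orbit C \<Omega> a x)"
  have "Ob (orbit C \<Omega> a x) c \<subseteq> Ob \<Upsilon> c" if b: "b \<in> Obj C" "y \<in> Ob \<Upsilon> b" for b c y
  proof
    fix z assume "z \<in> Ob (orbit C \<Omega> a x) c"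
    moreover have "orbit C \<Omega> b y = orbit C \<Omega> a x"
      using \<Upsilon> b \<Omega> x by (intro orbit_eq) (auto simp: csubset_def)
    ultimately have "z \<in> Ob (orbit C \<Omega> b y) c"
      by simp
    then obtain h where "h \<in> Arr C" "Dom C h = b" "Cod C h = c" "z = Mp \<Omega> h y"
      by (auto simp: orbit_def)
    moreover from this have "Mp \<Upsilon> h y = Mp \<Omega> h y"
      using \<Upsilon> b by (auto simp: csubset_def)
    ultimately show "z \<in> Ob \<Upsilon> c"
      using \<Upsilon> b is_cset_Mp[of C \<Upsilon> h b c y] by (auto simp: csubset_def)
  qed
  then show "(\<forall>b\<in>Obj C. Ob \<Upsilon> b = Ob (orbit C \<Omega> a x) b) \<or> (\<forall>b\<in>Obj C. Ob \<Upsilon> b = {})"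
    using \<Upsilon> unfolding csubset_def by blast
qed

text \<open>Replaces the union over all simple \<open>C\<close>-subsets by a condition on single
  elements: elements of simple \<open>C\<close>-subsets are recurrent, and a recurrent element lies
  in its own simple orbit.\<close>

lemma Ob_soc:
  assumes \<Omega>: "is_cset C \<Omega>" and a: "a \<in> Obj C"
  shows "Ob (soc C \<Omega>) a = {x \<in> Ob \<Omega> a. recurrent C \<Omega> a x}"
proof (intro equalityI subsetI)
  fix x assume "x \<in> Ob (soc C \<Omega>) a"
  then obtain \<Upsilon> where \<Upsilon>: "csubset C \<Upsilon> \<Omega>" "simple_cset C \<Upsilon>" and x: "x \<in> Ob \<Upsilon> a"
    by (auto simp: soc_def)
  have Mp: "Mp \<Upsilon> f y = Mp \<Omega> f y" if "f \<in> Arr C" "y \<in> Ob \<Upsilon> (Dom C f)" for f y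
    using \<Upsilon>(1) that by (auto simp: csubset_def)
  have "recurrent C \<Omega> a x"
    unfolding recurrent_def
  proof (intro ballI impI)
    fix f assume f: "f \<in> Arr C" "Dom C f = a"
    then obtain g where g: "g \<in> Arr C" "Dom C g = Cod C f" "Cod C g = a" "Mp \<Upsilon> g (Mp \<Upsilon> f x) = x"
      by (rule recurrentD[OF simple_cset_recurrent[OF \<Upsilon>(2) a x]])
    \<comment> \<open>The maps of \<open>\<Upsilon>\<close> and \<open>\<Omega>\<close> agree only
      on elements of \<open>\<Upsilon>\<close>, so \<open>f x\<close> must be placed there before
      \<open>g\<close> is transferred.\<close>
    moreover have "Mp \<Upsilon> f x \<in> Ob \<Upsilon> (Dom C g)"
      using \<Upsilon>(2) f g x by (auto simp: simple_cset_def is_csetD)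
    ultimately show "\<exists>g\<in>Arr C. Dom C g = Cod C f \<and> Cod C g = a \<and> Mp \<Omega> g (Mp \<Omega> f x) = x"
      using f x Mp by metis
  qed
  with \<Upsilon>(1) a x show "x \<in> {x \<in> Ob \<Omega> a. recurrent C \<Omega> a x}"
    by (auto simp: csubset_def)
next
  fix x assume "x \<in> {x \<in> Ob \<Omega> a. recurrent C \<Omega> a x}"
  then show "x \<in> Ob (soc C \<Omega>) a"
    using simple_orbit[OF \<Omega> a, of x] csubset_orbit[OF \<Omega> a, of x] by (auto simp: soc_def)
qed

lemma is_cset_soc [simp]:
  assumes \<Omega>: "is_cset C \<Omega>"
  shows "is_cset C (soc C \<Omega>)"
  using \<Omega> by (intro is_csetI) (auto simp: Ob_soc is_csetD Dom_in Cod_in recurrent_Mp)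

section \<open>Isomorphisms of \<open>C\<close>-sets and the constructions that respect them\<close>

lemma cset_isoI:
  assumes \<Omega>: "is_cset C \<Omega>" and \<Psi>: "is_cset C \<Psi>"
    and e: "\<And>a x. a \<in> Obj C \<Longrightarrow> x \<in> Ob \<Omega> a \<Longrightarrow> e a x \<in> Ob \<Psi> a \<and> d a (e a x) = x"
    and d: "\<And>a y. a \<in> Obj C \<Longrightarrow> y \<in> Ob \<Psi> a \<Longrightarrow> d a y \<in> Ob \<Omega> a \<and> e a (d a y) = y"
    and nat: "\<And>f x. f \<in> Arr C \<Longrightarrow> x \<in> Ob \<Omega> (Dom C f) \<Longrightarrow> e (Cod C f) (Mp \<Omega> f x) = Mp \<Psi> f (e (Dom C f) x)"
  shows "cset_iso C \<Omega> \<Psi>"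
proof -
  \<comment> \<open>The families \<open>e\<close> and \<open>d\<close> are arbitrary outside the
    relevant sets; restricting them yields the extensional functions required by
    \<open>cset_hom\<close>.\<close>
  let ?\<eta> = "\<lambda>a\<in>Obj C. \<lambda>x\<in>Ob \<Omega> a. e a x" and ?\<theta> = "\<lambda>a\<in>Obj C. \<lambda>y\<in>Ob \<Psi> a. d a y"
  \<comment> \<open>Naturality is assumed for \<open>e\<close> alone; its pointwise inverse inherits
    it.\<close>
  have nat': "d (Cod C f) (Mp \<Psi> f y) = Mp \<Omega> f (d (Dom C f) y)"
    if "f \<in> Arr C" "y \<in> Ob \<Psi> (Dom C f)" for f y
    using that e d nat[of f "d (Dom C f) y"] \<Omega> by (metis Cod_in Dom_in is_cset_Mp)
  have "?\<eta> \<in> Hom\<^sub>C\<^sub>S C \<Omega> \<Psi>"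
    using \<Omega> e nat by (auto simp: cset_hom_def Dom_in Cod_in is_csetD)
  moreover have "?\<theta> \<in> Hom\<^sub>C\<^sub>S C \<Psi> \<Omega>"
    using \<Psi> d nat' by (auto simp: cset_hom_def Dom_in Cod_in is_csetD)
  moreover have "\<forall>a\<in>Obj C. (\<forall>x\<in>Ob \<Omega> a. ?\<theta> a (?\<eta> a x) = x) \<and> (\<forall>y\<in>Ob \<Psi> a. ?\<eta> a (?\<theta> a y) = y)"
    using e d by simp
  ultimately show ?thesis
    unfolding cset_iso_def by blast
qed

lemma cset_isoE:
  assumes "cset_iso C \<Omega> \<Psi>"
  obtains e d where "\<And>a x. a \<in> Obj C \<Longrightarrow> x \<in> Ob \<Omega> a \<Longrightarrow> e a x \<in> Ob \<Psi> a \<and> d a (e a x) = x"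
    "\<And>a y. a \<in> Obj C \<Longrightarrow> y \<in> Ob \<Psi> a \<Longrightarrow> d a y \<in> Ob \<Omega> a \<and> e a (d a y) = y"
    "\<And>f x. f \<in> Arr C \<Longrightarrow> x \<in> Ob \<Omega> (Dom C f) \<Longrightarrow> e (Cod C f) (Mp \<Omega> f x) = Mp \<Psi> f (e (Dom C f) x)"
proof -
  obtain \<eta> \<theta> where "\<eta> \<in> Hom\<^sub>C\<^sub>S C \<Omega> \<Psi>" "\<theta> \<in> Hom\<^sub>C\<^sub>S C \<Psi> \<Omega>"
    "\<forall>a \<in> Obj C. (\<forall>x \<in> Ob \<Omega> a. \<theta> a (\<eta> a x) = x) \<and> (\<forall>y \<in> Ob \<Psi> a. \<eta> a (\<theta> a y) = y)"
    using assms by (auto simp: cset_iso_def)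
  then show thesis
    by (intro that[of \<eta> \<theta>]) (auto simp: cset_hom_def PiE_iff)
qed

lemma cset_iso_sym: "cset_iso C \<Omega> \<Psi> \<Longrightarrow> cset_iso C \<Psi> \<Omega>"
  unfolding cset_iso_def by blast

lemma cset_iso_trans:
  assumes "is_cset C \<Omega>" "is_cset C \<Phi>" "cset_iso C \<Omega> \<Psi>" "cset_iso C \<Psi> \<Phi>"
  shows "cset_iso C \<Omega> \<Phi>"
proof -
  obtain e d where ed: "\<And>a x. a \<in> Obj C \<Longrightarrow> x \<in> Ob \<Omega> a \<Longrightarrow> e a x \<in> Ob \<Psi> a \<and> d a (e a x) = x"
    "\<And>a y. a \<in> Obj C \<Longrightarrow> y \<in> Ob \<Psi> a \<Longrightarrow> d a y \<in> Ob \<Omega> a \<and> e a (d a y) = y"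
    "\<And>f x. f \<in> Arr C \<Longrightarrow> x \<in> Ob \<Omega> (Dom C f) \<Longrightarrow> e (Cod C f) (Mp \<Omega> f x) = Mp \<Psi> f (e (Dom C f) x)"
    by (rule cset_isoE[OF assms(3)]) (rule that)
  obtain e' d' where ed': "\<And>a x. a \<in> Obj C \<Longrightarrow> x \<in> Ob \<Psi> a \<Longrightarrow> e' a x \<in> Ob \<Phi> a \<and> d' a (e' a x) = x"
    "\<And>a y. a \<in> Obj C \<Longrightarrow> y \<in> Ob \<Phi> a \<Longrightarrow> d' a y \<in> Ob \<Psi> a \<and> e' a (d' a y) = y"
    "\<And>f x. f \<in> Arr C \<Longrightarrow> x \<in> Ob \<Psi> (Dom C f) \<Longrightarrow> e' (Cod C f) (Mp \<Psi> f x) = Mp \<Phi> f (e' (Dom C f) x)"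
    by (rule cset_isoE[OF assms(4)]) (rule that)
  show ?thesis
    by (rule cset_isoI[OF assms(1,2), where e = "\<lambda>a x. e' a (e a x)" and d = "\<lambda>a x. d a (d' a x)"])
      (simp_all add: ed ed' Dom_in)
qed

lemma csum_cong:
  assumes "is_cset C \<Omega>" "is_cset C \<Omega>'" "is_cset C \<Psi>" "is_cset C \<Psi>'"
    and "cset_iso C \<Omega> \<Omega>'" "cset_iso C \<Psi> \<Psi>'"
  shows "cset_iso C (csum \<Omega> \<Psi>) (csum \<Omega>' \<Psi>')"
proof -
  obtain e d where ed: "\<And>a x. a \<in> Obj C \<Longrightarrow> x \<in> Ob \<Omega> a \<Longrightarrow> e a x \<in> Ob \<Omega>' a \<and> d a (e a x) = x"
    "\<And>a y. a \<in> Obj C \<Longrightarrow> y \<in> Ob \<Omega>' a \<Longrightarrow> d a y \<in> Ob \<Omega> a \<and> e a (d a y) = y"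
    "\<And>f x. f \<in> Arr C \<Longrightarrow> x \<in> Ob \<Omega> (Dom C f) \<Longrightarrow> e (Cod C f) (Mp \<Omega> f x) = Mp \<Omega>' f (e (Dom C f) x)"
    by (rule cset_isoE[OF assms(5)]) (rule that)
  obtain e' d' where ed': "\<And>a x. a \<in> Obj C \<Longrightarrow> x \<in> Ob \<Psi> a \<Longrightarrow> e' a x \<in> Ob \<Psi>' a \<and> d' a (e' a x) = x"
    "\<And>a y. a \<in> Obj C \<Longrightarrow> y \<in> Ob \<Psi>' a \<Longrightarrow> d' a y \<in> Ob \<Psi> a \<and> e' a (d' a y) = y"
    "\<And>f x. f \<in> Arr C \<Longrightarrow> x \<in> Ob \<Psi> (Dom C f) \<Longrightarrow> e' (Cod C f) (Mp \<Psi> f x) = Mp \<Psi>' f (e' (Dom C f) x)"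
    by (rule cset_isoE[OF assms(6)]) (rule that)
  show ?thesis
    by (rule cset_isoI[where e = "\<lambda>a. map_sum (e a) (e' a)" and d = "\<lambda>a. map_sum (d a) (d' a)"])
      (use assms in \<open>auto simp: ed ed' Dom_in\<close>)
qed

lemma cprod_cong:
  assumes "is_cset C \<Omega>" "is_cset C \<Omega>'" "is_cset C \<Psi>" "is_cset C \<Psi>'"
    and "cset_iso C \<Omega> \<Omega>'" "cset_iso C \<Psi> \<Psi>'"
  shows "cset_iso C (cprod \<Omega> \<Psi>) (cprod \<Omega>' \<Psi>')"
proof -
  obtain e d where ed: "\<And>a x. a \<in> Obj C \<Longrightarrow> x \<in> Ob \<Omega> a \<Longrightarrow> e a x \<in> Ob \<Omega>' a \<and> d a (e a x) = x"
    "\<And>a y. a \<in> Obj C \<Longrightarrow> y \<in> Ob \<Omega>' a \<Longrightarrow> d a y \<in> Ob \<Omega> a \<and> e a (d a y) = y"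
    "\<And>f x. f \<in> Arr C \<Longrightarrow> x \<in> Ob \<Omega> (Dom C f) \<Longrightarrow> e (Cod C f) (Mp \<Omega> f x) = Mp \<Omega>' f (e (Dom C f) x)"
    by (rule cset_isoE[OF assms(5)]) (rule that)
  obtain e' d' where ed': "\<And>a x. a \<in> Obj C \<Longrightarrow> x \<in> Ob \<Psi> a \<Longrightarrow> e' a x \<in> Ob \<Psi>' a \<and> d' a (e' a x) = x"
    "\<And>a y. a \<in> Obj C \<Longrightarrow> y \<in> Ob \<Psi>' a \<Longrightarrow> d' a y \<in> Ob \<Psi> a \<and> e' a (d' a y) = y"
    "\<And>f x. f \<in> Arr C \<Longrightarrow> x \<in> Ob \<Psi> (Dom C f) \<Longrightarrow> e' (Cod C f) (Mp \<Psi> f x) = Mp \<Psi>' f (e' (Dom C f) x)"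
    by (rule cset_isoE[OF assms(6)]) (rule that)
  show ?thesis
    by (rule cset_isoI[where e = "\<lambda>a. map_prod (e a) (e' a)" and d = "\<lambda>a. map_prod (d a) (d' a)"])
      (use assms in \<open>auto simp: ed ed' Dom_in\<close>)
qed

text \<open>Applying the natural map \<open>e\<close> to \<open>g f x = x\<close> gives the same
  relation for the image, so the same \<open>g\<close> works.\<close>

lemma recurrent_hom:
  assumes "is_cset C \<Omega>" "a \<in> Obj C" "x \<in> Ob \<Omega> a" "recurrent C \<Omega> a x"
    and nat: "\<And>f x. f \<in> Arr C \<Longrightarrow> x \<in> Ob \<Omega> (Dom C f) \<Longrightarrow> e (Cod C f) (Mp \<Omega> f x) = Mp \<Psi> f (e (Dom C f) x)"
  shows "recurrent C \<Psi> a (e a x)"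
  unfolding recurrent_def
proof (intro ballI impI)
  fix f assume f: "f \<in> Arr C" "Dom C f = a"
  with assms(4) obtain g where g: "g \<in> Arr C" "Dom C g = Cod C f" "Cod C g = a" "Mp \<Omega> g (Mp \<Omega> f x) = x"
    by (rule recurrentD)
  then have "Mp \<Psi> g (Mp \<Psi> f (e a x)) = e a x"
    using nat[of f x] nat[of g "Mp \<Omega> f x"] f assms(1,3) by (simp add: is_csetD)
  with g show "\<exists>g\<in>Arr C. Dom C g = Cod C f \<and> Cod C g = a \<and> Mp \<Psi> g (Mp \<Psi> f (e a x)) = e a x"
    by auto
qed

text \<open>Both directions of the isomorphism are natural, hence preserve recurrent elements and
  restrict to the socles.\<close>

lemma soc_cong:
  assumes "is_cset C \<Omega>" "is_cset C \<Psi>" and iso: "cset_iso C \<Omega> \<Psi>"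
  shows "cset_iso C (soc C \<Omega>) (soc C \<Psi>)"
proof -
  obtain e d where ed: "\<And>a x. a \<in> Obj C \<Longrightarrow> x \<in> Ob \<Omega> a \<Longrightarrow> e a x \<in> Ob \<Psi> a \<and> d a (e a x) = x"
    "\<And>a y. a \<in> Obj C \<Longrightarrow> y \<in> Ob \<Psi> a \<Longrightarrow> d a y \<in> Ob \<Omega> a \<and> e a (d a y) = y"
    and nat: "\<And>f x. f \<in> Arr C \<Longrightarrow> x \<in> Ob \<Omega> (Dom C f) \<Longrightarrow> e (Cod C f) (Mp \<Omega> f x) = Mp \<Psi> f (e (Dom C f) x)"
    using cset_isoE[OF iso] by metis
  have nat': "d (Cod C f) (Mp \<Psi> f y) = Mp \<Omega> f (d (Dom C f) y)"
    if "f \<in> Arr C" "y \<in> Ob \<Psi> (Dom C f)" for f y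
    using that ed nat[of f "d (Dom C f) y"] assms(1) by (metis Cod_in Dom_in is_cset_Mp)
  have "recurrent C \<Psi> a (e a x)" if "a \<in> Obj C" "x \<in> Ob \<Omega> a" "recurrent C \<Omega> a x" for a x
    by (rule recurrent_hom[OF assms(1) that nat])
  moreover have "recurrent C \<Omega> a (d a y)" if "a \<in> Obj C" "y \<in> Ob \<Psi> a" "recurrent C \<Psi> a y" for a y
    by (rule recurrent_hom[OF assms(2) that nat'])
  ultimately show ?thesis
    by (intro cset_isoI[where e = e and d = d]) (use assms in \<open>simp_all add: Ob_soc ed nat Dom_in\<close>)
qed

end

section \<open>Semiring laws up to isomorphism\<close>

lemma is_cset_cfamily_sum:
  assumes "finite I" and "\<And>i. i \<in> I \<Longrightarrow> is_cset C (F i)"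
  shows "is_cset C (cfamily_sum I F)"
  using assms(1) by (intro is_csetI) (auto simp: is_csetD[OF assms(2)])

lemma recurrent_cfamily_sum [simp]:
  "recurrent C (cfamily_sum I F) a (i, x) \<longleftrightarrow> recurrent C (F i) a x"
  by (simp add: recurrent_def)

lemma recurrent_cprod_assoc:
  "recurrent C (cprod (cprod \<Omega> \<Psi>) \<Phi>) a ((x, y), z) \<longleftrightarrow> recurrent C (cprod \<Omega> (cprod \<Psi> \<Phi>)) a (x, (y, z))"
  by (simp add: recurrent_def)

lemma recurrent_cprod_csum [simp]:
  "recurrent C (cprod (csum \<Omega> \<Psi>) \<Phi>) a (Inl x, z) \<longleftrightarrow> recurrent C (cprod \<Omega> \<Phi>) a (x, z)"
  "recurrent C (cprod (csum \<Omega> \<Psi>) \<Phi>) a (Inr y, z) \<longleftrightarrow> recurrent C (cprod \<Psi> \<Phi>) a (y, z)"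
  "recurrent C (cprod \<Phi> (csum \<Omega> \<Psi>)) a (z, Inl x) \<longleftrightarrow> recurrent C (cprod \<Phi> \<Omega>) a (z, x)"
  "recurrent C (cprod \<Phi> (csum \<Omega> \<Psi>)) a (z, Inr y) \<longleftrightarrow> recurrent C (cprod \<Phi> \<Psi>) a (z, y)"
  by (simp_all add: recurrent_def)

lemma recurrent_cprod_cterminal [simp]:
  "recurrent C (cprod cterminal \<Omega>) a (u, x) \<longleftrightarrow> recurrent C \<Omega> a x"
  "recurrent C (cprod \<Omega> cterminal) a (x, u) \<longleftrightarrow> recurrent C \<Omega> a x"
  by (simp_all add: recurrent_def)

text \<open>The point over \<open>a\<close> is recurrent as soon as every morphism out of
  \<open>a\<close> has some morphism back, and any recurrent element over \<open>a\<close> supplies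
  these.\<close>

lemma recurrent_cterminal: "recurrent C \<Omega> a x \<Longrightarrow> recurrent C cterminal a u"
  by (auto simp: recurrent_def)

context category
begin

lemma csum_assoc:
  assumes "is_cset C \<Omega>" "is_cset C \<Psi>" "is_cset C \<Phi>"
  shows "cset_iso C (csum (csum \<Omega> \<Psi>) \<Phi>) (csum \<Omega> (csum \<Psi> \<Phi>))"
  by (rule cset_isoI[where e = "\<lambda>a. case_sum (case_sum Inl (Inr \<circ> Inl)) (Inr \<circ> Inr)"
        and d = "\<lambda>a. case_sum (Inl \<circ> Inl) (case_sum (Inl \<circ> Inr) Inr)"])
    (use assms in auto)

lemma csum_commute:
  assumes "is_cset C \<Omega>" "is_cset C \<Psi>"
  shows "cset_iso C (csum \<Omega> \<Psi>) (csum \<Psi> \<Omega>)"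
  by (rule cset_isoI[where e = "\<lambda>a. case_sum Inr Inl" and d = "\<lambda>a. case_sum Inr Inl"])
    (use assms in auto)

lemma csum_cempty:
  assumes "is_cset C \<Omega>"
  shows "cset_iso C (csum cempty \<Omega>) \<Omega>"
  by (rule cset_isoI[where e = "\<lambda>a. projr" and d = "\<lambda>a. Inr"]) (use assms in auto)

lemma soc_cprod_assoc:
  assumes "is_cset C \<Omega>" "is_cset C \<Psi>" "is_cset C \<Phi>"
  shows "cset_iso C (soc C (cprod (soc C (cprod \<Omega> \<Psi>)) \<Phi>)) (soc C (cprod \<Omega> (soc C (cprod \<Psi> \<Phi>))))"
proof -
  \<comment> \<open>The left-hand inner socle also asks for recurrence of the first two coordinates.
    This follows from recurrence of the triple, so the inner socle imposes nothing new.\<close>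
  have "recurrent C (cprod \<Omega> \<Psi>) a (x, y)" if "recurrent C (cprod \<Omega> (cprod \<Psi> \<Phi>)) a (x, (y, z))" for a x y z
    using that recurrent_cprodD(1)[of C "cprod \<Omega> \<Psi>" \<Phi> a "(x, y)" z] by (simp add: recurrent_cprod_assoc)
  then show ?thesis
    by (intro cset_isoI[where e = "\<lambda>a ((x, y), z). (x, (y, z))" and d = "\<lambda>a (x, (y, z)). ((x, y), z)"])
      (use assms in \<open>auto simp: Ob_soc Dom_in recurrent_cprod_assoc dest: recurrent_cprodD\<close>)
qed

lemma soc_cprod_csum_distrib_right:
  assumes "is_cset C \<Omega>" "is_cset C \<Psi>" "is_cset C \<Phi>"
  shows "cset_iso C (soc C (cprod (csum \<Omega> \<Psi>) \<Phi>)) (csum (soc C (cprod \<Omega> \<Phi>)) (soc C (cprod \<Psi> \<Phi>)))"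
  by (rule cset_isoI[where e = "\<lambda>a (s, z). map_sum (\<lambda>x. (x, z)) (\<lambda>y. (y, z)) s"
        and d = "\<lambda>a. case_sum (map_prod Inl id) (map_prod Inr id)"])
    (use assms in \<open>auto simp: Ob_soc Dom_in\<close>)

lemma soc_cprod_csum_distrib_left:
  assumes "is_cset C \<Omega>" "is_cset C \<Psi>" "is_cset C \<Phi>"
  shows "cset_iso C (soc C (cprod \<Phi> (csum \<Omega> \<Psi>))) (csum (soc C (cprod \<Phi> \<Omega>)) (soc C (cprod \<Phi> \<Psi>)))"
  by (rule cset_isoI[where e = "\<lambda>a (z, s). map_sum (Pair z) (Pair z) s"
        and d = "\<lambda>a. case_sum (map_prod id Inl) (map_prod id Inr)"])
    (use assms in \<open>auto simp: Ob_soc Dom_in\<close>)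

lemma soc_cprod_cempty:
  assumes "is_cset C \<Omega>"
  shows "cset_iso C (soc C (cprod cempty \<Omega>)) cempty" "cset_iso C (soc C (cprod \<Omega> cempty)) cempty"
  by (rule cset_isoI; use assms in \<open>auto simp: Ob_soc Dom_in\<close>)+

text \<open>Pairing with the point does not affect recurrence, so the hypothesis that all elements
  of \<open>\<Omega>\<close> are recurrent ensures that the socles discard nothing.\<close>

lemma soc_cprod_cterminal:
  assumes "is_cset C \<Omega>" "\<And>a x. a \<in> Obj C \<Longrightarrow> x \<in> Ob \<Omega> a \<Longrightarrow> recurrent C \<Omega> a x"
  shows "cset_iso C (soc C (cprod (soc C cterminal) \<Omega>)) \<Omega>"
    and "cset_iso C (soc C (cprod \<Omega> (soc C cterminal))) \<Omega>"
  by (rule cset_isoI[where e = "\<lambda>a. snd" and d = "\<lambda>a. Pair ()"]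
      cset_isoI[where e = "\<lambda>a. fst" and d = "\<lambda>a x. (x, ())"];
      use assms in \<open>auto simp: Ob_soc Dom_in intro: recurrent_cterminal\<close>)+

lemma recurrent_iso:
  assumes "is_cset C \<Omega>" "is_cset C \<Psi>" and iso: "cset_iso C \<Omega> \<Psi>"
    and rec: "\<And>a x. a \<in> Obj C \<Longrightarrow> x \<in> Ob \<Omega> a \<Longrightarrow> recurrent C \<Omega> a x"
    and y: "a \<in> Obj C" "y \<in> Ob \<Psi> a"
  shows "recurrent C \<Psi> a y"
proof -
  obtain e d where ed: "\<And>a x. a \<in> Obj C \<Longrightarrow> x \<in> Ob \<Omega> a \<Longrightarrow> e a x \<in> Ob \<Psi> a \<and> d a (e a x) = x"
    "\<And>a y. a \<in> Obj C \<Longrightarrow> y \<in> Ob \<Psi> a \<Longrightarrow> d a y \<in> Ob \<Omega> a \<and> e a (d a y) = y"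
    and nat: "\<And>f x. f \<in> Arr C \<Longrightarrow> x \<in> Ob \<Omega> (Dom C f) \<Longrightarrow> e (Cod C f) (Mp \<Omega> f x) = Mp \<Psi> f (e (Dom C f) x)"
    by (rule cset_isoE[OF iso]) (rule that)
  have "d a y \<in> Ob \<Omega> a" "e a (d a y) = y"
    using ed y by auto
  with recurrent_hom[OF assms(1) y(1) _ rec nat, of "d a y"] y(1) show ?thesis
    by simp
qed

end

section \<open>Semisimple \<open>C\<close>-sets\<close>

context finite_category
begin

text \<open>All values of \<open>\<Omega>\<close> together form a finite set, which injects into the
  naturals; the maps are conjugated by this injection.\<close>

lemma ex_nat_cset:
  assumes \<Omega>: "is_cset C \<Omega>"
  shows "\<exists>\<Omega>' :: (_, _, nat) cset. is_cset C \<Omega>' \<and> cset_iso C \<Omega> \<Omega>'"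
proof -
  let ?E = "\<Union>a\<in>Obj C. Ob \<Omega> a"
  have "finite ?E"
    using \<Omega> finite_Obj by (auto simp: is_csetD)
  then obtain i :: "_ \<Rightarrow> nat" where inj: "inj_on i ?E"
    by (meson finite_imp_inj_to_nat_seg)
  define \<Omega>' :: "(_, _, nat) cset" where
    "\<Omega>' = \<lparr>Ob = \<lambda>a. i ` Ob \<Omega> a, Mp = \<lambda>f y. i (Mp \<Omega> f (inv_into ?E i y))\<rparr>"
  have inv: "inv_into ?E i (i x) = x" if "a \<in> Obj C" "x \<in> Ob \<Omega> a" for a x
    using inj that by (intro inv_into_f_f) auto
  have simps: "Ob \<Omega>' a = i ` Ob \<Omega> a" "a \<in> Obj C \<Longrightarrow> x \<in> Ob \<Omega> a \<Longrightarrow> Mp \<Omega>' f (i x) = i (Mp \<Omega> f x)" for a f x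
    using inv by (auto simp: \<Omega>'_def)
  have "is_cset C \<Omega>'"
    using \<Omega> by (intro is_csetI) (auto simp: simps is_csetD simps(2)[OF Dom_in] simps(2)[OF Cod_in])
  moreover from this have "cset_iso C \<Omega> \<Omega>'"
    using \<Omega> by (intro cset_isoI[where e = "\<lambda>a. i" and d = "\<lambda>a. inv_into ?E i"])
      (auto simp: simps(1) inv simps(2)[OF Dom_in])
  ultimately show ?thesis by blast
qed

text \<open>Elements of simple summands are recurrent, and isomorphisms transport this. Conversely,
  if all elements are recurrent, the orbits are simple and partition
  \<open>\<Omega>\<close>.\<close>

lemma semisimple_cset_iff:
  fixes \<Omega> :: "(_, _, 'x) cset"
  shows "semisimple_cset C \<Omega> \<longleftrightarrow> is_cset C \<Omega> \<and> (\<forall>a \<in> Obj C. \<forall>x \<in> Ob \<Omega> a. recurrent C \<Omega> a x)"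
proof (intro iffI conjI ballI)
  assume ss: "semisimple_cset C \<Omega>"
  then show \<Omega>: "is_cset C \<Omega>"
    by (simp add: semisimple_cset_def)
  from ss obtain I :: "nat set" and F :: "nat \<Rightarrow> (_, _, 'x) cset"
    where F: "finite I" "\<forall>i\<in>I. simple_cset C (F i)" "cset_iso C \<Omega> (cfamily_sum I F)"
    by (auto simp: semisimple_cset_def)
  have "is_cset C (cfamily_sum I F)"
    using F by (intro is_cset_cfamily_sum) (auto simp: simple_cset_def)
  moreover have "recurrent C (cfamily_sum I F) a z"
    if "a \<in> Obj C" "z \<in> Ob (cfamily_sum I F) a" for a z
    using that F(2) by (auto simp: simple_cset_recurrent)
  ultimately show "recurrent C \<Omega> a x" if "a \<in> Obj C" "x \<in> Ob \<Omega> a" for a x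
    using recurrent_iso[OF _ \<Omega> cset_iso_sym[OF F(3)]] that by blast
next
  assume "is_cset C \<Omega> \<and> (\<forall>a \<in> Obj C. \<forall>x \<in> Ob \<Omega> a. recurrent C \<Omega> a x)"
  then have \<Omega>: "is_cset C \<Omega>" and rec: "\<And>a x. a \<in> Obj C \<Longrightarrow> x \<in> Ob \<Omega> a \<Longrightarrow> recurrent C \<Omega> a x"
    by auto
  \<comment> \<open>Different elements may generate the same orbit; the set \<open>Q\<close> lists
    each orbit once. It is then enumerated because \<open>semisimple_cset\<close> indexes its
    summands by naturals.\<close>
  define Q where "Q = (\<lambda>(a, x). orbit C \<Omega> a x) ` Sigma (Obj C) (Ob \<Omega>)"
  have "finite Q"
    using \<Omega> finite_Obj by (auto simp: Q_def is_csetD)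
  then obtain F where F: "bij_betw F {0..<card Q} Q"
    using ex_bij_betw_nat_finite by blast
  define ix where "ix a x = inv_into {0..<card Q} F (orbit C \<Omega> a x)" for a x
  have orbit_in: "orbit C \<Omega> a x \<in> Q" if "a \<in> Obj C" "x \<in> Ob \<Omega> a" for a x
    using that by (auto simp: Q_def)
  have ix: "ix a x \<in> {0..<card Q}" "F (ix a x) = orbit C \<Omega> a x" if "a \<in> Obj C" "x \<in> Ob \<Omega> a" for a x
    using orbit_in[OF that] F unfolding ix_def
    by (metis bij_betw_imp_surj_on inv_into_into, metis bij_betw_imp_surj_on f_inv_into_f)
  have F_orbit: "\<exists>a x. a \<in> Obj C \<and> x \<in> Ob \<Omega> a \<and> F i = orbit C \<Omega> a x" if "i \<in> {0..<card Q}" for i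
    using F that by (force simp: Q_def bij_betw_def)
  have simple: "simple_cset C (F i)" if "i \<in> {0..<card Q}" for i
    using F_orbit[OF that] simple_orbit[OF \<Omega>] rec by metis
  \<comment> \<open>Disjointness of the orbits: an element of the orbit numbered \<open>i\<close>
    generates that orbit, so its own number is \<open>i\<close>.\<close>
  have F_elem: "y \<in> Ob \<Omega> b \<and> ix b y = i" if i: "i \<in> {0..<card Q}" and b: "b \<in> Obj C" "y \<in> Ob (F i) b" for i b y
  proof -
    obtain a x where a: "a \<in> Obj C" "x \<in> Ob \<Omega> a" "F i = orbit C \<Omega> a x"
      using F_orbit[OF i] by blast
    then have "y \<in> Ob \<Omega> b"
      using csubset_orbit(1)[OF \<Omega> a(1,2)] b by (auto simp: csubset_def)
    moreover have "orbit C \<Omega> b y = F i"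
      using orbit_eq[OF \<Omega> rec[OF a(1,2)] a(2), of y b] a b by simp
    then have "ix b y = i"
      using F i by (auto simp: ix_def bij_betw_def)
    ultimately show ?thesis ..
  qed
  have Mp_F: "Mp (F i) = Mp \<Omega>" if "i \<in> {0..<card Q}" for i
    using F_orbit[OF that] by auto
  have in_orbit: "x \<in> Ob (orbit C \<Omega> a x) a" if "a \<in> Obj C" "x \<in> Ob \<Omega> a" for a x
    using csubset_orbit(2)[OF \<Omega> that] .
  have "cset_iso C \<Omega> (cfamily_sum {0..<card Q} F)"
  proof (rule cset_isoI[OF \<Omega>, where e = "\<lambda>a x. (ix a x, x)" and d = "\<lambda>a. snd"])
    show "is_cset C (cfamily_sum {0..<card Q} F)"
      using simple by (intro is_cset_cfamily_sum) (auto simp: simple_cset_def)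
    fix f x assume f: "f \<in> Arr C" "x \<in> Ob \<Omega> (Dom C f)"
    then have "Mp \<Omega> f x \<in> Ob (orbit C \<Omega> (Dom C f) x) (Cod C f)"
      by (auto simp: orbit_def)
    \<comment> \<open>Naturality of the decomposition: maps stay within an orbit and therefore keep
      its number.\<close>
    then have "ix (Cod C f) (Mp \<Omega> f x) = ix (Dom C f) x"
      using f ix[OF Dom_in] F_elem[OF _ Cod_in] by metis
    then show "(ix (Cod C f) (Mp \<Omega> f x), Mp \<Omega> f x) =
        Mp (cfamily_sum {0..<card Q} F) f (ix (Dom C f) x, x)"
      using f ix(1)[OF Dom_in] Mp_F by simp
  qed (use ix F_elem in_orbit in \<open>fastforce+\<close>)
  with \<Omega> simple show "semisimple_cset C \<Omega>"
    unfolding semisimple_cset_def by blast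
qed

end

section \<open>Counting morphisms out of a simple \<open>C\<close>-set\<close>

text \<open>The kernel of the Yoneda map determined by \<open>x\<close>. Dividing the representable
  functor at \<open>a\<close> by it gives the orbit of \<open>x\<close>, which is \<open>S\<close>
  if \<open>S\<close> is simple.\<close>

definition kernel_pairs :: "('o, 'm) category \<Rightarrow> ('o, 'm, 's) cset \<Rightarrow> 'o \<Rightarrow> 's \<Rightarrow> ('m \<times> 'm) set" where
  "kernel_pairs C S a x = {(f, g). f \<in> Arr C \<and> g \<in> Arr C \<and> Dom C f = a \<and> Dom C g = a \<and>
     Cod C f = Cod C g \<and> Mp S f x = Mp S g x}"

text \<open>These are the \<open>y\<close> whose Yoneda map factors through the orbit of
  \<open>x\<close>, that is, the possible images of \<open>x\<close> under natural transformations
  from that orbit.\<close>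

definition hom_values :: "('o, 'm) category \<Rightarrow> ('o, 'm, 's) cset \<Rightarrow> 'o \<Rightarrow> 's \<Rightarrow> ('o, 'm, 'x) cset \<Rightarrow> 'x set" where
  "hom_values C S a x \<Omega> = {y \<in> Ob \<Omega> a. \<forall>(f, g) \<in> kernel_pairs C S a x. Mp \<Omega> f y = Mp \<Omega> g y}"

lemma hom_valuesI:
  assumes "y \<in> Ob \<Omega> a"
    and "\<And>f g. f \<in> Arr C \<Longrightarrow> g \<in> Arr C \<Longrightarrow> Dom C f = a \<Longrightarrow> Dom C g = a \<Longrightarrow> Cod C f = Cod C g \<Longrightarrow>
      Mp S f x = Mp S g x \<Longrightarrow> Mp \<Omega> f y = Mp \<Omega> g y"
  shows "y \<in> hom_values C S a x \<Omega>"
  unfolding hom_values_def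
proof (intro CollectI conjI ballI, rule assms(1), clarify)
  fix f g assume "(f, g) \<in> kernel_pairs C S a x"
  then show "Mp \<Omega> f y = Mp \<Omega> g y"
    unfolding kernel_pairs_def mem_Collect_eq prod.case by (elim conjE) (rule assms(2))
qed

lemma hom_valuesD:
  assumes "y \<in> hom_values C S a x \<Omega>"
  shows "y \<in> Ob \<Omega> a"
    and "f \<in> Arr C \<Longrightarrow> g \<in> Arr C \<Longrightarrow> Dom C f = a \<Longrightarrow> Dom C g = a \<Longrightarrow> Cod C f = Cod C g \<Longrightarrow>
      Mp S f x = Mp S g x \<Longrightarrow> Mp \<Omega> f y = Mp \<Omega> g y"
proof -
  show "y \<in> Ob \<Omega> a"
    using assms by (simp add: hom_values_def)
  assume "f \<in> Arr C" "g \<in> Arr C" "Dom C f = a" "Dom C g = a" "Cod C f = Cod C g" "Mp S f x = Mp S g x"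
  then have "(f, g) \<in> kernel_pairs C S a x"
    by (simp add: kernel_pairs_def)
  then show "Mp \<Omega> f y = Mp \<Omega> g y"
    using assms by (auto simp: hom_values_def)
qed

lemma hom_values_csum: "hom_values C S a x (csum \<Omega> \<Psi>) = hom_values C S a x \<Omega> <+> hom_values C S a x \<Psi>"
  by (auto simp: hom_values_def)

lemma hom_values_cprod: "hom_values C S a x (cprod \<Omega> \<Psi>) = hom_values C S a x \<Omega> \<times> hom_values C S a x \<Psi>"
  by (auto simp: hom_values_def)

lemma cset_homD:
  assumes "\<eta> \<in> Hom\<^sub>C\<^sub>S C \<Omega> \<Psi>"
  shows "a \<in> Obj C \<Longrightarrow> x \<in> Ob \<Omega> a \<Longrightarrow> \<eta> a x \<in> Ob \<Psi> a"
    and "f \<in> Arr C \<Longrightarrow> Dom C f = a \<Longrightarrow> x \<in> Ob \<Omega> a \<Longrightarrow> \<eta> (Cod C f) (Mp \<Omega> f x) = Mp \<Psi> f (\<eta> a x)"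
  using assms by (auto simp: cset_hom_def PiE_iff)

lemma cset_hom_eqI:
  assumes "\<eta> \<in> Hom\<^sub>C\<^sub>S C \<Omega> \<Psi>" "\<theta> \<in> Hom\<^sub>C\<^sub>S C \<Omega> \<Psi>"
    and "\<And>a x. a \<in> Obj C \<Longrightarrow> x \<in> Ob \<Omega> a \<Longrightarrow> \<eta> a x = \<theta> a x"
  shows "\<eta> = \<theta>"
proof (rule PiE_ext)
  show "\<eta> \<in> (\<Pi>\<^sub>E a \<in> Obj C. Ob \<Omega> a \<rightarrow>\<^sub>E Ob \<Psi> a)" "\<theta> \<in> (\<Pi>\<^sub>E a \<in> Obj C. Ob \<Omega> a \<rightarrow>\<^sub>E Ob \<Psi> a)"
    using assms(1,2) by (auto simp: cset_hom_def)
  then show "\<eta> a = \<theta> a" if "a \<in> Obj C" for a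
    using that assms(3) by (intro PiE_ext[of "\<eta> a" "Ob \<Omega> a" "\<lambda>_. Ob \<Psi> a"]) (auto simp: PiE_iff)
qed

context category
begin

text \<open>A transformation is determined by the image of the generator \<open>x\<close>.
  Conversely, an admissible \<open>y\<close> defines one by sending \<open>f x\<close> to
  \<open>f y\<close>.\<close>

lemma bij_betw_hom_values:
  assumes S: "simple_cset C S" and a: "a \<in> Obj C" and x: "x \<in> Ob S a" and \<Omega>: "is_cset C \<Omega>"
  shows "bij_betw (\<lambda>\<eta>. \<eta> a x) (Hom\<^sub>C\<^sub>S C S \<Omega>) (hom_values C S a x \<Omega>)"
proof (rule bij_betw_imageI)
  have S_cset: "is_cset C S"
    using S by (simp add: simple_cset_def)
  have gen: "\<exists>f\<in>Arr C. Dom C f = a \<and> Cod C f = b \<and> Mp S f x = z" if "b \<in> Obj C" "z \<in> Ob S b" for b z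
  proof -
    have "z \<in> Ob (orbit C S a x) b"
      using simple_cset_orbit_eq[OF S a x that(1)] that(2) by simp
    then show ?thesis
      by (auto simp: orbit_def)
  qed
  show "inj_on (\<lambda>\<eta>. \<eta> a x) (Hom\<^sub>C\<^sub>S C S \<Omega>)"
  proof (rule inj_onI)
    fix \<eta> \<theta> assume hom: "\<eta> \<in> Hom\<^sub>C\<^sub>S C S \<Omega>" "\<theta> \<in> Hom\<^sub>C\<^sub>S C S \<Omega>" and eq: "\<eta> a x = \<theta> a x"
    show "\<eta> = \<theta>"
    proof (rule cset_hom_eqI[OF hom])
      fix b z assume "b \<in> Obj C" "z \<in> Ob S b"
      with gen obtain f where "f \<in> Arr C" "Dom C f = a" "Cod C f = b" "Mp S f x = z" by blast
      then show "\<eta> b z = \<theta> b z"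
        using cset_homD(2)[OF hom(1)] cset_homD(2)[OF hom(2)] x eq by metis
    qed
  qed
  show "(\<lambda>\<eta>. \<eta> a x) ` Hom\<^sub>C\<^sub>S C S \<Omega> = hom_values C S a x \<Omega>"
  proof (intro equalityI subsetI)
    fix y assume "y \<in> (\<lambda>\<eta>. \<eta> a x) ` Hom\<^sub>C\<^sub>S C S \<Omega>"
    then obtain \<eta> where \<eta>: "\<eta> \<in> Hom\<^sub>C\<^sub>S C S \<Omega>" "y = \<eta> a x" by blast
    show "y \<in> hom_values C S a x \<Omega>"
    proof (rule hom_valuesI)
      show "y \<in> Ob \<Omega> a"
        using cset_homD(1)[OF \<eta>(1) a x] \<eta>(2) by simp
      show "Mp \<Omega> f y = Mp \<Omega> g y" if "f \<in> Arr C" "g \<in> Arr C" "Dom C f = a" "Dom C g = a"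
        "Cod C f = Cod C g" "Mp S f x = Mp S g x" for f g
        using cset_homD(2)[OF \<eta>(1) that(1,3) x] cset_homD(2)[OF \<eta>(1) that(2,4) x] that(5,6) \<eta>(2) by simp
    qed
  next
    fix y assume y: "y \<in> hom_values C S a x \<Omega>"
    \<comment> \<open>Chooses a morphism that carries the generator \<open>x\<close> to
      \<open>z\<close>.\<close>
    define c where "c b z = (SOME f. f \<in> Arr C \<and> Dom C f = a \<and> Cod C f = b \<and> Mp S f x = z)" for b z
    have c: "c b z \<in> Arr C \<and> Dom C (c b z) = a \<and> Cod C (c b z) = b \<and> Mp S (c b z) x = z"
      if "b \<in> Obj C" "z \<in> Ob S b" for b z
      unfolding c_def by (rule someI_ex) (use gen[OF that] in blast)
    define \<eta> where "\<eta> = (\<lambda>b\<in>Obj C. \<lambda>z\<in>Ob S b. Mp \<Omega> (c b z) y)"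
    have y_in: "y \<in> Ob \<Omega> a"
      using y by (rule hom_valuesD)
    \<comment> \<open>Independence of the choice: the chosen morphism and \<open>f\<close> agree at
      \<open>x\<close>, so they form a kernel pair and agree at \<open>y\<close>.\<close>
    have \<eta>: "\<eta> (Cod C f) (Mp S f x) = Mp \<Omega> f y" if f: "f \<in> Arr C" "Dom C f = a" for f
    proof -
      have "Mp S f x \<in> Ob S (Cod C f)"
        using S_cset f x by (auto simp: is_csetD)
      moreover from c[OF Cod_in[OF f(1)] this] f
      have "Mp \<Omega> (c (Cod C f) (Mp S f x)) y = Mp \<Omega> f y"
        by (intro hom_valuesD(2)[OF y]) simp_all
      ultimately show ?thesis
        using f by (simp add: \<eta>_def Cod_in)
    qed
    have "\<eta> \<in> Hom\<^sub>C\<^sub>S C S \<Omega>"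
    proof -
      have "Mp \<Omega> (c b z) y \<in> Ob \<Omega> b" if "b \<in> Obj C" "z \<in> Ob S b" for b z
        using c[OF that] \<Omega> y_in by (auto simp: is_csetD)
      then have "\<eta> \<in> (\<Pi>\<^sub>E b \<in> Obj C. Ob S b \<rightarrow>\<^sub>E Ob \<Omega> b)"
        by (auto simp: \<eta>_def)
      moreover have "\<eta> (Cod C f) (Mp S f z) = Mp \<Omega> f (\<eta> (Dom C f) z)"
        if f: "f \<in> Arr C" and z: "z \<in> Ob S (Dom C f)" for f z
      proof -
        obtain g where g: "g \<in> Arr C" "Dom C g = a" "Cod C g = Dom C f" "Mp S g x = z"
          using gen[OF Dom_in[OF f] z] by blast
        \<comment> \<open>Writing \<open>z\<close> as \<open>g x\<close> turns naturality at
          \<open>z\<close> into the formula for \<open>\<eta>\<close> at the composite of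
          \<open>f\<close> and \<open>g\<close>.\<close>
        have "\<eta> (Cod C f) (Mp S f z) = \<eta> (Cod C (Comp C f g)) (Mp S (Comp C f g) x)"
          using f g x S_cset by (simp add: Cod_Comp is_csetD)
        also have "\<dots> = Mp \<Omega> (Comp C f g) y"
          using f g by (intro \<eta>) (simp_all add: Comp_in Dom_Comp)
        also have "\<dots> = Mp \<Omega> f (Mp \<Omega> g y)"
          using f g \<Omega> y_in by (simp add: is_csetD)
        also have "Mp \<Omega> g y = \<eta> (Dom C f) z"
          using \<eta>[OF g(1,2)] g by simp
        finally show ?thesis .
      qed
      ultimately show ?thesis
        by (simp add: cset_hom_def)
    qed
    moreover have "\<eta> a x = y"
      using \<eta>[OF Ident_in[OF a]] a x y_in S_cset \<Omega> by (simp add: Dom_Ident Cod_Ident is_csetD)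
    ultimately show "y \<in> (\<lambda>\<eta>. \<eta> a x) ` Hom\<^sub>C\<^sub>S C S \<Omega>"
      by blast
  qed
qed

section \<open>Cardinalities of \<open>Hom\<close> sets under isomorphism, sums, socles of products
  and the units\<close>

lemma card_hom_eq:
  assumes "simple_cset C S" "a \<in> Obj C" "x \<in> Ob S a" "is_cset C \<Omega>"
  shows "card (Hom\<^sub>C\<^sub>S C S \<Omega>) = card (hom_values C S a x \<Omega>)"
  using bij_betw_same_card[OF bij_betw_hom_values[OF assms]] .

lemma simple_cset_elemE:
  assumes "simple_cset C S"
  obtains a x where "a \<in> Obj C" "x \<in> Ob S a"
  using assms by (auto simp: simple_cset_def)

lemma card_hom_iso:
  assumes S: "simple_cset C S" and \<Omega>: "is_cset C \<Omega>" and \<Psi>: "is_cset C \<Psi>" and iso: "cset_iso C \<Omega> \<Psi>"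
  shows "card (Hom\<^sub>C\<^sub>S C S \<Omega>) = card (Hom\<^sub>C\<^sub>S C S \<Psi>)"
proof -
  obtain a x where x: "a \<in> Obj C" "x \<in> Ob S a"
    using S by (rule simple_cset_elemE)
  obtain e d where ed: "\<And>a x. a \<in> Obj C \<Longrightarrow> x \<in> Ob \<Omega> a \<Longrightarrow> e a x \<in> Ob \<Psi> a \<and> d a (e a x) = x"
    "\<And>a y. a \<in> Obj C \<Longrightarrow> y \<in> Ob \<Psi> a \<Longrightarrow> d a y \<in> Ob \<Omega> a \<and> e a (d a y) = y"
    and nat: "\<And>f x. f \<in> Arr C \<Longrightarrow> x \<in> Ob \<Omega> (Dom C f) \<Longrightarrow> e (Cod C f) (Mp \<Omega> f x) = Mp \<Psi> f (e (Dom C f) x)"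
    by (rule cset_isoE[OF iso]) (rule that)
  \<comment> \<open>Naturality together with injectivity of \<open>e\<close> over the common
    codomain shows that the kernel conditions on \<open>y\<close> and on its image are
    equivalent.\<close>
  have Mp_e: "Mp \<Psi> f (e a y) = Mp \<Psi> g (e a y) \<longleftrightarrow> Mp \<Omega> f y = Mp \<Omega> g y"
    if "y \<in> Ob \<Omega> a" "f \<in> Arr C" "g \<in> Arr C" "Dom C f = a" "Dom C g = a" "Cod C f = Cod C g" for f g y
  proof -
    have "Mp \<Psi> f (e a y) = e (Cod C g) (Mp \<Omega> f y)" "Mp \<Psi> g (e a y) = e (Cod C g) (Mp \<Omega> g y)"
      using nat[of f y] nat[of g y] that by simp_all
    moreover have "Mp \<Omega> f y \<in> Ob \<Omega> (Cod C g)" "Mp \<Omega> g y \<in> Ob \<Omega> (Cod C g)"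
      using \<Omega> that by (simp_all add: is_csetD)
    ultimately show ?thesis
      using ed(1)[OF Cod_in[OF that(3)]] by metis
  qed
  have "bij_betw (e a) (hom_values C S a x \<Omega>) (hom_values C S a x \<Psi>)"
  proof (rule bij_betwI')
    show "e a y = e a y' \<longleftrightarrow> y = y'" if "y \<in> hom_values C S a x \<Omega>" "y' \<in> hom_values C S a x \<Omega>" for y y'
      using ed(1)[OF x(1)] hom_valuesD(1)[OF that(1)] hom_valuesD(1)[OF that(2)] by metis
    show "e a y \<in> hom_values C S a x \<Psi>" if y: "y \<in> hom_values C S a x \<Omega>" for y
    proof (rule hom_valuesI)
      show "e a y \<in> Ob \<Psi> a"
        using ed(1)[OF x(1) hom_valuesD(1)[OF y]] ..
      show "Mp \<Psi> f (e a y) = Mp \<Psi> g (e a y)" if fg: "f \<in> Arr C" "g \<in> Arr C" "Dom C f = a" "Dom C g = a"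
        "Cod C f = Cod C g" "Mp S f x = Mp S g x" for f g
        using Mp_e[OF hom_valuesD(1)[OF y] fg(1-5)] hom_valuesD(2)[OF y fg] by simp
    qed
    show "\<exists>y\<in>hom_values C S a x \<Omega>. z = e a y" if z: "z \<in> hom_values C S a x \<Psi>" for z
    proof
      have "d a z \<in> Ob \<Omega> a" and eq: "e a (d a z) = z"
        using ed(2)[OF x(1) hom_valuesD(1)[OF z]] by auto
      show "d a z \<in> hom_values C S a x \<Omega>"
      proof (rule hom_valuesI)
        show "Mp \<Omega> f (d a z) = Mp \<Omega> g (d a z)" if "f \<in> Arr C" "g \<in> Arr C" "Dom C f = a" "Dom C g = a"
          "Cod C f = Cod C g" "Mp S f x = Mp S g x" for f g
          using Mp_e[OF \<open>d a z \<in> Ob \<Omega> a\<close> that(1-5)] hom_valuesD(2)[OF z that] eq by simp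
      qed fact
      show "z = e a (d a z)" using eq ..
    qed
  qed
  then show ?thesis
    using card_hom_eq[OF S x \<Omega>] card_hom_eq[OF S x \<Psi>] by (simp add: bij_betw_same_card)
qed

lemma card_hom_csum:
  assumes S: "simple_cset C S" and \<Omega>: "is_cset C \<Omega>" and \<Psi>: "is_cset C \<Psi>"
  shows "card (Hom\<^sub>C\<^sub>S C S (csum \<Omega> \<Psi>)) = card (Hom\<^sub>C\<^sub>S C S \<Omega>) + card (Hom\<^sub>C\<^sub>S C S \<Psi>)"
proof -
  obtain a x where x: "a \<in> Obj C" "x \<in> Ob S a"
    using S by (rule simple_cset_elemE)
  have "finite (hom_values C S a x \<Omega>)" "finite (hom_values C S a x \<Psi>)"
    using is_cset_finite[OF \<Omega> x(1)] is_cset_finite[OF \<Psi> x(1)] by (simp_all add: hom_values_def)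
  then show ?thesis
    using \<Omega> \<Psi> by (simp add: card_hom_eq[OF S x] hom_values_csum card_Plus)
qed

lemma hom_values_soc:
  assumes S: "simple_cset C S" and x: "a \<in> Obj C" "x \<in> Ob S a" and \<Omega>: "is_cset C \<Omega>"
  shows "hom_values C S a x (soc C \<Omega>) = hom_values C S a x \<Omega>"
proof -
  have "recurrent C \<Omega> a y" if y: "y \<in> hom_values C S a x \<Omega>" for y
    unfolding recurrent_def
  proof (intro ballI impI)
    fix f assume f: "f \<in> Arr C" "Dom C f = a"
    then obtain g where g: "g \<in> Arr C" "Dom C g = Cod C f" "Cod C g = a" "Mp S g (Mp S f x) = x"
      by (rule recurrentD[OF simple_cset_recurrent[OF S x]])
    have S_cset: "is_cset C S"
      using S by (simp add: simple_cset_def)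
    \<comment> \<open>Since \<open>g f x = x\<close>, the composite and the identity of
      \<open>a\<close> form a kernel pair at \<open>x\<close>; hence they agree at
      \<open>y\<close>.\<close>
    have "Mp \<Omega> (Comp C g f) y = Mp \<Omega> (Ident C a) y"
      using f g x S_cset by (intro hom_valuesD(2)[OF y])
        (simp_all add: Comp_in Ident_in Dom_Comp Cod_Comp Dom_Ident Cod_Ident is_csetD)
    then have "Mp \<Omega> g (Mp \<Omega> f y) = y"
      using f g x \<Omega> hom_valuesD(1)[OF y] by (simp add: is_csetD)
    with g show "\<exists>g\<in>Arr C. Dom C g = Cod C f \<and> Cod C g = a \<and> Mp \<Omega> g (Mp \<Omega> f y) = y"
      by blast
  qed
  moreover have "hom_values C S a x (soc C \<Omega>) = {y \<in> hom_values C S a x \<Omega>. recurrent C \<Omega> a y}"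
    by (auto simp: hom_values_def Ob_soc[OF \<Omega> x(1)])
  ultimately show ?thesis
    by blast
qed

text \<open>Morphisms out of \<open>S\<close> already land in the socle, so the socle may be
  dropped; a morphism into the product is then a pair of morphisms.\<close>

lemma card_hom_soc_cprod:
  assumes S: "simple_cset C S" and \<Omega>: "is_cset C \<Omega>" and \<Psi>: "is_cset C \<Psi>"
  shows "card (Hom\<^sub>C\<^sub>S C S (soc C (cprod \<Omega> \<Psi>))) = card (Hom\<^sub>C\<^sub>S C S \<Omega>) * card (Hom\<^sub>C\<^sub>S C S \<Psi>)"
proof -
  obtain a x where x: "a \<in> Obj C" "x \<in> Ob S a"
    using S by (rule simple_cset_elemE)
  then show ?thesis
    using \<Omega> \<Psi> by (simp add: card_hom_eq[OF S x] hom_values_soc[OF S x] hom_values_cprod card_cartesian_product)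
qed

lemma card_hom_soc_cterminal:
  assumes S: "simple_cset C S"
  shows "card (Hom\<^sub>C\<^sub>S C S (soc C cterminal)) = 1"
proof -
  obtain a x where x: "a \<in> Obj C" "x \<in> Ob S a"
    using S by (rule simple_cset_elemE)
  have "hom_values C S a x cterminal = {()}"
    by (auto simp: hom_values_def)
  then show ?thesis
    by (simp add: card_hom_eq[OF S x] hom_values_soc[OF S x])
qed

text \<open>A simple \<open>S\<close> has an element, which would have no image. This gives the
  subtracted term zero when the mark is evaluated on a class
  \<open>burnside_class C \<Omega>\<close>.\<close>

lemma card_hom_cempty:
  assumes S: "simple_cset C S"
  shows "card (Hom\<^sub>C\<^sub>S C S cempty) = 0"
proof -
  obtain a x where x: "a \<in> Obj C" "x \<in> Ob S a"
    using S by (rule simple_cset_elemE)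
  then show ?thesis
    by (simp add: card_hom_eq[OF S x] hom_values_def)
qed

end

section \<open>The simple Burnside semiring and the mark\<close>

context finite_category
begin

lemma semisimple_csum:
  "semisimple_cset C \<Omega> \<Longrightarrow> semisimple_cset C \<Psi> \<Longrightarrow> semisimple_cset C (csum \<Omega> \<Psi>)"
  by (auto simp: semisimple_cset_iff)

lemma semisimple_soc: "is_cset C \<Omega> \<Longrightarrow> semisimple_cset C (soc C \<Omega>)"
  by (simp add: semisimple_cset_iff Ob_soc)

lemma semisimple_cempty: "semisimple_cset C cempty"
  by (simp add: semisimple_cset_iff)

lemma semisimple_is_cset: "semisimple_cset C \<Omega> \<Longrightarrow> is_cset C \<Omega>"
  by (simp add: semisimple_cset_def)

section \<open>Isomorphism classes and the semiring they form\<close>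

lemma iso_class_eqI:
  assumes "is_cset C \<Omega>" "is_cset C \<Psi>" "cset_iso C \<Omega> \<Psi>"
  shows "iso_class C \<Omega> = iso_class C \<Psi>"
proof -
  have "cset_iso C \<Omega> \<Upsilon> \<longleftrightarrow> cset_iso C \<Psi> \<Upsilon>" if "is_cset C \<Upsilon>" for \<Upsilon> :: "(_, _, nat) cset"
    using cset_iso_trans[OF assms(1) that assms(3)]
      cset_iso_trans[OF assms(2) that cset_iso_sym[OF assms(3)]] by metis
  then show ?thesis
    by (auto simp: iso_class_def)
qed

lemma ex_nat_semisimple:
  assumes "semisimple_cset C \<Omega>"
  shows "\<exists>\<Omega>' :: (_, _, nat) cset. semisimple_cset C \<Omega>' \<and> cset_iso C \<Omega> \<Omega>'"
proof -
  have \<Omega>: "is_cset C \<Omega>"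
    using assms by (rule semisimple_is_cset)
  with ex_nat_cset obtain \<Omega>' :: "(_, _, nat) cset" where \<Omega>': "is_cset C \<Omega>'" "cset_iso C \<Omega> \<Omega>'"
    by blast
  have "semisimple_cset C \<Omega>'"
    using assms recurrent_iso[OF \<Omega> \<Omega>'] \<Omega>'(1) by (simp add: semisimple_cset_iff)
  with \<Omega>'(2) show ?thesis by blast
qed

text \<open>Sums and products leave the type of naturals while the carrier is built from
  \<open>C\<close>-sets of naturals, so an isomorphic copy has to be supplied.\<close>

lemma iso_class_in_carrier:
  assumes "semisimple_cset C \<Omega>"
  shows "iso_class C \<Omega> \<in> carrier (simple_burnside_semiring C)"
proof -
  obtain \<Omega>' :: "(_, _, nat) cset" where "semisimple_cset C \<Omega>'" "cset_iso C \<Omega> \<Omega>'"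
    using ex_nat_semisimple[OF assms] by blast
  moreover from this assms have "iso_class C \<Omega> = iso_class C \<Omega>'"
    by (intro iso_class_eqI semisimple_is_cset)
  ultimately show ?thesis
    by (auto simp: simple_burnside_semiring_def)
qed

lemma burnside_carrierE:
  assumes "X \<in> carrier (simple_burnside_semiring C)"
  obtains \<Omega> :: "(_, _, nat) cset" where "semisimple_cset C \<Omega>" "X = iso_class C \<Omega>"
  using assms by (auto simp: simple_burnside_semiring_def)

text \<open>The operations are unions over representatives, so an empty class would make them
  collapse to the empty set.\<close>

lemma iso_class_nonempty: "is_cset C \<Omega> \<Longrightarrow> iso_class C \<Omega> \<noteq> {}"
  using ex_nat_cset by (auto simp: iso_class_def)

text \<open>All terms of the union over representatives equal the class on the right, by
  \<open>csum_cong\<close>; the multiplicative analogue below uses \<open>cprod_cong\<close> and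
  \<open>soc_cong\<close>.\<close>

lemma iso_class_add:
  assumes "is_cset C \<Omega>" "is_cset C \<Psi>"
  shows "iso_class C \<Omega> \<oplus>\<^bsub>simple_burnside_semiring C\<^esub> iso_class C \<Psi> = iso_class C (csum \<Omega> \<Psi>)"
proof -
  have "iso_class C (csum \<Omega>' \<Psi>') = iso_class C (csum \<Omega> \<Psi>)"
    if "\<Omega>' \<in> iso_class C \<Omega>" "\<Psi>' \<in> iso_class C \<Psi>" for \<Omega>' \<Psi>'
    using assms that
    by (intro iso_class_eqI csum_cong is_cset_csum)
      (auto simp: iso_class_def intro: cset_iso_sym)
  then show ?thesis
    using iso_class_nonempty[OF assms(1)] iso_class_nonempty[OF assms(2)]
    by (simp add: simple_burnside_semiring_def)
qed

lemma iso_class_mult: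
  assumes "is_cset C \<Omega>" "is_cset C \<Psi>"
  shows "iso_class C \<Omega> \<otimes>\<^bsub>simple_burnside_semiring C\<^esub> iso_class C \<Psi> = iso_class C (soc C (cprod \<Omega> \<Psi>))"
proof -
  have "iso_class C (soc C (cprod \<Omega>' \<Psi>')) = iso_class C (soc C (cprod \<Omega> \<Psi>))"
    if "\<Omega>' \<in> iso_class C \<Omega>" "\<Psi>' \<in> iso_class C \<Psi>" for \<Omega>' \<Psi>'
    using assms that
    by (intro iso_class_eqI soc_cong cprod_cong is_cset_soc is_cset_cprod)
      (auto simp: iso_class_def intro: cset_iso_sym)
  then show ?thesis
    using iso_class_nonempty[OF assms(1)] iso_class_nonempty[OF assms(2)]
    by (simp add: simple_burnside_semiring_def)
qed

lemma iso_class_zero: "\<zero>\<^bsub>simple_burnside_semiring C\<^esub> = iso_class C (cempty :: (_, _, nat) cset)"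
  and iso_class_one: "\<one>\<^bsub>simple_burnside_semiring C\<^esub> = iso_class C (soc C cterminal)"
  by (simp_all add: simple_burnside_semiring_def)

text \<open>Each law becomes, on representatives, one of the isomorphisms established above.\<close>

lemma semiring_simple_burnside: "semiring (simple_burnside_semiring C)"
proof (intro semiring.intro abelian_monoidI monoidI semiring_axioms.intro)
  note [simp] = iso_class_add iso_class_mult iso_class_in_carrier semisimple_csum semisimple_soc semisimple_cempty
  let ?M = "simple_burnside_semiring C"
  show "\<zero>\<^bsub>?M\<^esub> \<in> carrier ?M" "\<one>\<^bsub>?M\<^esub> \<in> carrier ?M"
    by (simp_all add: iso_class_zero iso_class_one)
  fix X assume "X \<in> carrier ?M"
  then obtain \<Omega> :: "(_, _, nat) cset" where \<Omega>: "semisimple_cset C \<Omega>" and X: "X = iso_class C \<Omega>"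
    by (rule burnside_carrierE)
  have [simp]: "is_cset C \<Omega>"
    using \<Omega> by (rule semisimple_is_cset)
  \<comment> \<open>Semisimplicity enters the unit laws in this form: without it, multiplication by
    one would return only the socle.\<close>
  from \<Omega> have rec: "recurrent C \<Omega> a x" if "a \<in> Obj C" "x \<in> Ob \<Omega> a" for a x
    using that by (simp add: semisimple_cset_iff)
  show "\<zero>\<^bsub>?M\<^esub> \<oplus>\<^bsub>?M\<^esub> X = X"
    by (simp_all add: X iso_class_zero, (intro iso_class_eqI csum_cempty; simp)+)
  show "\<one>\<^bsub>?M\<^esub> \<otimes>\<^bsub>?M\<^esub> X = X" "X \<otimes>\<^bsub>?M\<^esub> \<one>\<^bsub>?M\<^esub> = X"
    by (simp_all add: X iso_class_one, (intro iso_class_eqI soc_cprod_cterminal; simp add: rec)+)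
  show "\<zero>\<^bsub>?M\<^esub> \<otimes>\<^bsub>?M\<^esub> X = \<zero>\<^bsub>?M\<^esub>" "X \<otimes>\<^bsub>?M\<^esub> \<zero>\<^bsub>?M\<^esub> = \<zero>\<^bsub>?M\<^esub>"
    by (simp_all add: X iso_class_zero, (intro iso_class_eqI soc_cprod_cempty; simp)+)
  fix Y assume "Y \<in> carrier ?M"
  then obtain \<Psi> :: "(_, _, nat) cset" where \<Psi>: "semisimple_cset C \<Psi>" and Y: "Y = iso_class C \<Psi>"
    by (rule burnside_carrierE)
  have [simp]: "is_cset C \<Psi>"
    using \<Psi> by (rule semisimple_is_cset)
  show "X \<oplus>\<^bsub>?M\<^esub> Y \<in> carrier ?M" "X \<otimes>\<^bsub>?M\<^esub> Y \<in> carrier ?M"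
    using \<Omega> \<Psi> by (simp_all add: X Y)
  show "X \<oplus>\<^bsub>?M\<^esub> Y = Y \<oplus>\<^bsub>?M\<^esub> X"
    by (simp_all add: X Y, (intro iso_class_eqI csum_commute; simp)+)
  fix Z assume "Z \<in> carrier ?M"
  then obtain \<Phi> :: "(_, _, nat) cset" where \<Phi>: "semisimple_cset C \<Phi>" and Z: "Z = iso_class C \<Phi>"
    by (rule burnside_carrierE)
  have [simp]: "is_cset C \<Phi>"
    using \<Phi> by (rule semisimple_is_cset)
  show "(X \<oplus>\<^bsub>?M\<^esub> Y) \<oplus>\<^bsub>?M\<^esub> Z = X \<oplus>\<^bsub>?M\<^esub> (Y \<oplus>\<^bsub>?M\<^esub> Z)"
    by (simp_all add: X Y Z, (intro iso_class_eqI csum_assoc; simp)+)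
  show "(X \<otimes>\<^bsub>?M\<^esub> Y) \<otimes>\<^bsub>?M\<^esub> Z = X \<otimes>\<^bsub>?M\<^esub> (Y \<otimes>\<^bsub>?M\<^esub> Z)"
    by (simp_all add: X Y Z, (intro iso_class_eqI soc_cprod_assoc; simp)+)
  show "(X \<oplus>\<^bsub>?M\<^esub> Y) \<otimes>\<^bsub>?M\<^esub> Z = X \<otimes>\<^bsub>?M\<^esub> Z \<oplus>\<^bsub>?M\<^esub> Y \<otimes>\<^bsub>?M\<^esub> Z"
    by (simp_all add: X Y Z, (intro iso_class_eqI soc_cprod_csum_distrib_right; simp)+)
  show "Z \<otimes>\<^bsub>?M\<^esub> (X \<oplus>\<^bsub>?M\<^esub> Y) = Z \<otimes>\<^bsub>?M\<^esub> X \<oplus>\<^bsub>?M\<^esub> Z \<otimes>\<^bsub>?M\<^esub> Y"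
    by (simp_all add: X Y Z, (intro iso_class_eqI soc_cprod_csum_distrib_left; simp)+)
qed

section \<open>The mark on the semiring and on its Grothendieck ring\<close>

definition class_mark :: "_ \<Rightarrow> (_, _, nat) cset set \<Rightarrow> int" where
  "class_mark S X = int (card (Hom\<^sub>C\<^sub>S C S (SOME \<Omega>. \<Omega> \<in> X)))"

text \<open>The representative picked by \<open>SOME\<close> is isomorphic to
  \<open>\<Omega>\<close>, and isomorphic \<open>C\<close>-sets receive equally many morphisms from
  \<open>S\<close>.\<close>

lemma class_mark_iso_class:
  assumes "simple_cset C S" "is_cset C \<Omega>"
  shows "class_mark S (iso_class C \<Omega>) = int (card (Hom\<^sub>C\<^sub>S C S \<Omega>))"
proof -
  have "(SOME \<Omega>'. \<Omega>' \<in> iso_class C \<Omega>) \<in> iso_class C \<Omega>"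
    using iso_class_nonempty[OF assms(2)] by (simp add: some_in_eq)
  then show ?thesis
    using card_hom_iso[OF assms, of "SOME \<Omega>'. \<Omega>' \<in> iso_class C \<Omega>"] unfolding class_mark_def
    by (simp only: iso_class_def mem_Collect_eq)
qed

lemma class_mark_add:
  assumes S: "simple_cset C S"
    and "X \<in> carrier (simple_burnside_semiring C)" "Y \<in> carrier (simple_burnside_semiring C)"
  shows "class_mark S (X \<oplus>\<^bsub>simple_burnside_semiring C\<^esub> Y) = class_mark S X + class_mark S Y"
  using assms by (auto elim!: burnside_carrierE
      simp: semisimple_is_cset iso_class_add class_mark_iso_class[OF S] card_hom_csum[OF S])

lemma class_mark_mult:
  assumes S: "simple_cset C S"
    and "X \<in> carrier (simple_burnside_semiring C)" "Y \<in> carrier (simple_burnside_semiring C)"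
  shows "class_mark S (X \<otimes>\<^bsub>simple_burnside_semiring C\<^esub> Y) = class_mark S X * class_mark S Y"
  using assms by (auto elim!: burnside_carrierE
      simp: semisimple_is_cset iso_class_mult class_mark_iso_class[OF S] card_hom_soc_cprod[OF S])

text \<open>Evaluates the definite description in \<open>mark\<close>: representatives of
  \<open>X\<close> and \<open>Y\<close> give existence, and additivity of \<open>class_mark\<close>
  gives uniqueness.\<close>

lemma mark_groth_class:
  assumes S: "simple_cset C S"
    and X: "X \<in> carrier (simple_burnside_semiring C)" and Y: "Y \<in> carrier (simple_burnside_semiring C)"
  shows "mark C S (groth_class (simple_burnside_semiring C) X Y) = class_mark S X - class_mark S Y"
proof -
  interpret M: semiring "simple_burnside_semiring C"
    by (rule semiring_simple_burnside)
  have minus: "burnside_class C \<Omega> \<ominus>\<^bsub>B\<^sup>S C\<^esub> burnside_class C \<Psi> =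
      groth_class (simple_burnside_semiring C) (iso_class C \<Omega>) (iso_class C \<Psi>)"
    if "semisimple_cset C \<Omega>" "semisimple_cset C \<Psi>" for \<Omega> \<Psi> :: "(_, _, nat) cset"
    using that by (simp add: burnside_class_def simple_burnside_ring_def M.groth_class_minus iso_class_in_carrier)
  show ?thesis
    unfolding mark_def
  proof (rule the_equality, goal_cases)
    case 1
    obtain \<Omega> :: "(_, _, nat) cset" where \<Omega>: "semisimple_cset C \<Omega>" "X = iso_class C \<Omega>"
      using X by (rule burnside_carrierE)
    obtain \<Psi> :: "(_, _, nat) cset" where \<Psi>: "semisimple_cset C \<Psi>" "Y = iso_class C \<Psi>"
      using Y by (rule burnside_carrierE)
    show ?case
    proof (intro exI conjI)
      show "groth_class (simple_burnside_semiring C) X Y = burnside_class C \<Omega> \<ominus>\<^bsub>B\<^sup>S C\<^esub> burnside_class C \<Psi>"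
        unfolding minus[OF \<Omega>(1) \<Psi>(1)] \<Omega>(2) \<Psi>(2) ..
      show "class_mark S X - class_mark S Y = int (card (Hom\<^sub>C\<^sub>S C S \<Omega>)) - int (card (Hom\<^sub>C\<^sub>S C S \<Psi>))"
        using \<Omega> \<Psi> by (simp add: class_mark_iso_class[OF S] semisimple_is_cset)
    qed fact+
  next
    case (2 n)
    then obtain \<Omega> \<Psi> :: "(_, _, nat) cset" where ss: "semisimple_cset C \<Omega>" "semisimple_cset C \<Psi>"
      and "groth_class (simple_burnside_semiring C) X Y =
        burnside_class C \<Omega> \<ominus>\<^bsub>B\<^sup>S C\<^esub> burnside_class C \<Psi>"
      and n: "n = int (card (Hom\<^sub>C\<^sub>S C S \<Omega>)) - int (card (Hom\<^sub>C\<^sub>S C S \<Psi>))"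
      by (elim exE conjE)
    then have eq: "groth_class (simple_burnside_semiring C) X Y =
        groth_class (simple_burnside_semiring C) (iso_class C \<Omega>) (iso_class C \<Psi>)"
      by (simp only: minus)
    note in_M = X Y ss[THEN iso_class_in_carrier]
    obtain Z where Z: "Z \<in> carrier (simple_burnside_semiring C)"
      and sum_eq: "X \<oplus>\<^bsub>simple_burnside_semiring C\<^esub> iso_class C \<Psi> \<oplus>\<^bsub>simple_burnside_semiring C\<^esub> Z =
        iso_class C \<Omega> \<oplus>\<^bsub>simple_burnside_semiring C\<^esub> Y \<oplus>\<^bsub>simple_burnside_semiring C\<^esub> Z"
      using eq in_M by (auto simp: M.groth_class_eq_iff)
    \<comment> \<open>Passing to the integers allows the auxiliary class \<open>Z\<close> to be
      cancelled, so two formal differences for the same element have the same value.\<close>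
    from arg_cong[OF sum_eq, of "class_mark S"]
    have "class_mark S X + class_mark S (iso_class C \<Psi>) = class_mark S (iso_class C \<Omega>) + class_mark S Y"
      using in_M Z by (simp add: class_mark_add[OF S])
    then show ?case
      using ss by (simp add: n class_mark_iso_class[OF S] semisimple_is_cset)
  qed
qed

end

theorem proposition4p2:
  fixes C :: "('o, 'm) category" and S :: "('o, 'm, 's) cset"
  assumes "finite_category C" and "connected_category C" and "simple_cset C S"
  shows "(\<forall>\<Omega> :: ('o, 'm, 'w) cset. semisimple_cset C \<Omega> \<longrightarrow>
            mark C S (burnside_class C \<Omega>) = int (card (Hom\<^sub>C\<^sub>S C S \<Omega>)))
         \<and> ring_hom_ring (B\<^sup>S C) \<Z> (mark C S)"
proof (intro conjI allI impI)
  interpret finite_category C by fact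
  interpret M: semiring "simple_burnside_semiring C"
    by (rule semiring_simple_burnside)
  note S = \<open>simple_cset C S\<close>
  \<comment> \<open>The class of \<open>\<Omega>\<close> is its difference with the empty
    \<open>C\<close>-set, which contributes zero to the count.\<close>
  show "mark C S (burnside_class C \<Omega>) = int (card (Hom\<^sub>C\<^sub>S C S \<Omega>))"
    if "semisimple_cset C \<Omega>" for \<Omega> :: "('o, 'm, 'w) cset"
    using that by (simp add: burnside_class_def mark_groth_class[OF S] iso_class_in_carrier iso_class_zero
        semisimple_cempty class_mark_iso_class[OF S] semisimple_is_cset card_hom_cempty[OF S])
  \<comment> \<open>The criterion is applied with \<open>class_mark S\<close> as the semiring map;
    the remaining condition, value one at the identity, is
    \<open>card_hom_soc_cterminal\<close>.\<close>
  show "ring_hom_ring (B\<^sup>S C) \<Z> (mark C S)"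
    unfolding simple_burnside_ring_def
    by (rule M.ring_hom_grothendieckI[OF mark_groth_class[OF S] class_mark_add[OF S] class_mark_mult[OF S]])
      (simp_all add: iso_class_one class_mark_iso_class[OF S] card_hom_soc_cterminal[OF S])
qed

end
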